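(* Let $k$ be a field and let $$S=\left\{\begin{pmatrix} f(x)& g(x)\\ 0& f(x^2)\end{pmatrix} : f,g\in k[x]\right\}+y\,M_2(k[x,y])\;\subset\; M_2(k[x,y]).$$ Then $S$ is an affine noetherian prime PI algebra that has no left noetherian finite $\mathbb{N}$-filtration.
   Context: Here $k[x,y]$ is the commutative polynomial ring and $M_2$ denotes $2\times 2$ matrices. An algebra is affine if it is finitely generated as a $k$-algebra; PI means satisfying a polynomial identity; noetherian means left and right noetherian. An $\mathbb{N}$-filtration $\Gamma=\{\Gamma_i : i\in\mathbb{N}\}$ of a $k$-algebra $A$ (with $0\in\mathbb N$) is an ascending chain of $k$-subspaces of $A$ with $1\in\Gamma_0$, $\bigcup_{j}\Gamma_j=A$ and $\Gamma_i\Gamma_j\subseteq\Gamma_{i+j}$ for all $i,j$. It is finite if $\dim_k\Gamma_i<\infty$ for all $i$. It is left noetherian if the associated graded ring $\operatorname{gr}_\Gamma A=\bigoplus_{i\ge 0}\Gamma_i/\Gamma_{i-1}$ (with $\Gamma_{-1}=0$) is left noetherian. *)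

theory Defs
  imports
    "HOL-Algebra.QuotRing"
    "HOL-Algebra.Ideal_Product"
    "HOL-Algebra.Generated_Rings"
    "HOL-Algebra.Embedded_Algebras"
    "HOL-Algebra.Product_Groups"
    "HOL-Computational_Algebra.Polynomial"
    "Jordan_Normal_Form.Matrix"
begin

section \<open>Noetherian, prime and PI algebras\<close>

text \<open>HOL-Algebra's \<open>noetherian_ring\<close> is a condition on two-sided ideals.\<close>

locale left_ideal = additive_subgroup I R for I and R (structure) +
  assumes left_closed: "\<lbrakk> a \<in> I; r \<in> carrier R \<rbrakk> \<Longrightarrow> r \<otimes> a \<in> I"

locale right_ideal = additive_subgroup I R for I and R (structure) +
  assumes right_closed: "\<lbrakk> a \<in> I; r \<in> carrier R \<rbrakk> \<Longrightarrow> a \<otimes> r \<in> I"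

definition left_noetherian :: "('a, 'b) ring_scheme \<Rightarrow> bool" where
  "left_noetherian R \<longleftrightarrow>
     (\<forall>I :: nat \<Rightarrow> 'a set. (\<forall>n. left_ideal (I n) R) \<and> (\<forall>n. I n \<subseteq> I (Suc n)) \<longrightarrow>
        (\<exists>N. \<forall>n\<ge>N. I n = I N))"

definition right_noetherian :: "('a, 'b) ring_scheme \<Rightarrow> bool" where
  "right_noetherian R \<longleftrightarrow>
     (\<forall>I :: nat \<Rightarrow> 'a set. (\<forall>n. right_ideal (I n) R) \<and> (\<forall>n. I n \<subseteq> I (Suc n)) \<longrightarrow>
        (\<exists>N. \<forall>n\<ge>N. I n = I N))"

definition prime_ring :: "('a, 'b) ring_scheme \<Rightarrow> bool" where
  "prime_ring R \<longleftrightarrow> \<one>\<^bsub>R\<^esub> \<noteq> \<zero>\<^bsub>R\<^esub> \<and>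
     (\<forall>I J. ideal I R \<and> ideal J R \<and> ideal_prod R I J = {\<zero>\<^bsub>R\<^esub>} \<longrightarrow>
        I = {\<zero>\<^bsub>R\<^esub>} \<or> J = {\<zero>\<^bsub>R\<^esub>})"

text \<open>Algebras over a field are rings \<open>A\<close> with a central subfield \<open>K\<close>, in the style of
  \<^locale>\<open>embedded_algebra\<close>. The library's \<^locale>\<open>subalgebra\<close> with
  arguments \<open>K V A\<close> only says that \<open>V\<close> is a \<open>K\<close>-subspace of \<open>A\<close>.\<close>

locale algebra_over = embedded_algebra K A for K and A (structure) +
  assumes central: "\<lbrakk> c \<in> K; a \<in> carrier A \<rbrakk> \<Longrightarrow> c \<otimes> a = a \<otimes> c"

definition affine_algebra :: "'a set \<Rightarrow> ('a, 'b) ring_scheme \<Rightarrow> bool" where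
  "affine_algebra K A \<longleftrightarrow>
     (\<exists>X. finite X \<and> X \<subseteq> carrier A \<and> generate_ring A (K \<union> X) = carrier A)"

text \<open>An element of the free algebra on noncommuting variables \<open>X\<^sub>0, X\<^sub>1, \<dots>\<close> over \<open>K\<close> is a
  finitely supported coefficient function on words; the word \<open>[i, j, \<dots>]\<close> is the monomial
  \<open>X\<^sub>i X\<^sub>j \<dots>\<close>.\<close>

definition free_algebra_carrier :: "'a set \<Rightarrow> ('a, 'b) ring_scheme \<Rightarrow> (nat list \<Rightarrow> 'a) set" where
  "free_algebra_carrier K A = {p. range p \<subseteq> K \<and> finite {w. p w \<noteq> \<zero>\<^bsub>A\<^esub>}}"

definition free_algebra_eval ::
    "('a, 'b) ring_scheme \<Rightarrow> (nat list \<Rightarrow> 'a) \<Rightarrow> (nat \<Rightarrow> 'a) \<Rightarrow> 'a" where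
  "free_algebra_eval A p a =
     (\<Oplus>\<^bsub>A\<^esub> w \<in> {w. p w \<noteq> \<zero>\<^bsub>A\<^esub>}.
        p w \<otimes>\<^bsub>A\<^esub> foldr (\<lambda>i b. a i \<otimes>\<^bsub>A\<^esub> b) w \<one>\<^bsub>A\<^esub>)"

definition PI_algebra :: "'a set \<Rightarrow> ('a, 'b) ring_scheme \<Rightarrow> bool" where
  "PI_algebra K A \<longleftrightarrow>
     (\<exists>p \<in> free_algebra_carrier K A. (\<exists>w. p w \<noteq> \<zero>\<^bsub>A\<^esub>) \<and>
        (\<forall>a. range a \<subseteq> carrier A \<longrightarrow> free_algebra_eval A p a = \<zero>\<^bsub>A\<^esub>))"


section \<open>Filtrations and the associated graded ring\<close>

locale N_filtration = algebra_over K A for K and A (structure) +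
  fixes \<Gamma> :: "nat \<Rightarrow> 'a set"
  assumes subspace: "subalgebra K (\<Gamma> i) A"
    and ascending: "\<Gamma> i \<subseteq> \<Gamma> (Suc i)"
    and one_in: "\<one> \<in> \<Gamma> 0"
    and exhaustive: "(\<Union>i. \<Gamma> i) = carrier A"
    and mult_in: "\<lbrakk> a \<in> \<Gamma> i; b \<in> \<Gamma> j \<rbrakk> \<Longrightarrow> a \<otimes> b \<in> \<Gamma> (i + j)"

definition finite_filtration :: "'a set \<Rightarrow> ('a, 'b) ring_scheme \<Rightarrow> (nat \<Rightarrow> 'a set) \<Rightarrow> bool" where
  "finite_filtration K A \<Gamma> \<longleftrightarrow> (\<forall>i. ring.finite_dimension A K (\<Gamma> i))"

text \<open>\<open>\<Gamma>\<^bsub>n-1\<^esub>\<close>, with \<open>\<Gamma>\<^bsub>-1\<^esub> = 0\<close>.\<close>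

definition filt_pred :: "('a, 'b) ring_scheme \<Rightarrow> (nat \<Rightarrow> 'a set) \<Rightarrow> nat \<Rightarrow> 'a set" where
  "filt_pred A \<Gamma> n = (case n of 0 \<Rightarrow> {\<zero>\<^bsub>A\<^esub>} | Suc m \<Rightarrow> \<Gamma> m)"

text \<open>The additive group \<open>\<Gamma>\<^bsub>n\<^esub>/\<Gamma>\<^bsub>n-1\<^esub>\<close>, as a multiplicatively written \<^typ>\<open>'a set monoid\<close>.\<close>

definition gr_component :: "('a, 'b) ring_scheme \<Rightarrow> (nat \<Rightarrow> 'a set) \<Rightarrow> nat \<Rightarrow> 'a set monoid" where
  "gr_component A \<Gamma> n = (A \<lparr> carrier := \<Gamma> n \<rparr>) A_Mod (filt_pred A \<Gamma> n)"

text \<open>Cosets \<open>X\<close> in degree \<open>i\<close> and \<open>Y\<close> in degree \<open>j\<close> have as product the coset of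
  \<open>\<Gamma>\<^bsub>i+j-1\<^esub>\<close> given by \<^const>\<open>rcoset_mult\<close>; the sum of such products over \<open>i + j = n\<close> is taken
  in \<open>\<Gamma>\<^bsub>n\<^esub>/\<Gamma>\<^bsub>n-1\<^esub>\<close>, hence the \<^const>\<open>finprod\<close>.\<close>

definition gr :: "('a, 'b) ring_scheme \<Rightarrow> (nat \<Rightarrow> 'a set) \<Rightarrow> (nat \<Rightarrow> 'a set) ring" where
  "gr A \<Gamma> =
    \<lparr> carrier = carrier (sum_group UNIV (gr_component A \<Gamma>)),
      monoid.mult = (\<lambda>F G n. \<Otimes>\<^bsub>gr_component A \<Gamma> n\<^esub> i \<in> {..n}.
                rcoset_mult A (filt_pred A \<Gamma> n) (F i) (G (n - i))),
      one = (\<lambda>n. if n = 0 then filt_pred A \<Gamma> 0 +>\<^bsub>A\<^esub> \<one>\<^bsub>A\<^esub> else \<one>\<^bsub>gr_component A \<Gamma> n\<^esub>),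
      zero = \<one>\<^bsub>sum_group UNIV (gr_component A \<Gamma>)\<^esub>,
      add = (\<lambda>F G. F \<otimes>\<^bsub>sum_group UNIV (gr_component A \<Gamma>)\<^esub> G) \<rparr>"


section \<open>The algebra\<close>

text \<open>\<^typ>\<open>'k poly poly\<close> is \<open>k[x][y]\<close>: the inner variable is \<open>x\<close>, the outer one \<open>y\<close>. So
  \<open>[:f:]\<close> is the polynomial \<open>f(x)\<close>, \<open>[:0, 1:]\<close> is \<open>y\<close>, and \<open>f \<circ>\<^sub>p [:0, 1:]^2\<close> is \<open>f(x^2)\<close>.\<close>

definition S_set :: "'k::field poly poly mat set" where
  "S_set = {mat_of_rows_list 2 [[ [:f:], [:g:] ], [ 0, [:f \<circ>\<^sub>p [:0, 1:]^2:] ]] + [:0, 1:] \<cdot>\<^sub>m M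
            | f g M. M \<in> carrier_mat 2 2}"

definition S_alg :: "'k::field poly poly mat ring" where
  "S_alg = (ring_mat TYPE('k poly poly) 2 ()) \<lparr> carrier := S_set \<rparr>"

text \<open>The copy of \<open>k\<close> in the matrix ring.\<close>

definition scalars :: "'k::field poly poly mat set" where
  "scalars = range (\<lambda>c. [:[:c:]:] \<cdot>\<^sub>m 1\<^sub>m 2)"

end

theory Submission
  imports Defs
begin

text \<open>
  Write \<open>\<sigma> = diag(x, x^2)\<close>.  The commutative polynomial algebra \<open>k[\<sigma>, y]\<close> is contained in \<open>S\<close>, and
  \<open>M\<^sub>2(k[x,y])\<close> is a finitely generated module over it from either side, because \<open>k[x,y]\<close> has rank
  two over \<open>k[x^2,y]\<close>.  Hence \<open>S\<close> is noetherian on both sides.  The proof runs Hilbert's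
  leading coefficient argument three times, from \<open>k\<close> to \<open>k[x]\<close>, from there to \<open>k[x,y]\<close>, and from there to
  the four matrix entries (\<open>acc_on_poly\<close>, \<open>matrix_chain_stops\<close>).  Three explicit elements generate \<open>S\<close>,
  primeness comes from \<open>y M\<^sub>2(k[x,y]) \<subseteq> S\<close>, and Hall's identity holds in \<open>2 \<times> 2\<close> matrices.

  Modulo \<open>y\<close>, an element of \<open>S\<close> is a pair \<open>(f, g)\<close> with
  \<open>(f, g) (f', g') = (f f', f g' + g f'(x^2))\<close>.  Suppose that a finite filtration \<open>\<Gamma>\<close> has a left
  noetherian associated graded ring, and let \<open>d(n)\<close> be the largest degree of \<open>f\<close> on \<open>\<Gamma>\<^bsub>n\<^esub>\<close>.
  A left noetherian graded ring is generated over its degree zero part by finitely many homogeneous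
  elements, so \<open>d(n)\<close> grows at most linearly.  The ideal \<open>I\<close> of the elements with \<open>f = 0\<close> has
  finitely generated leading terms as a left ideal, and \<open>S\<close> acts on it from the left through \<open>f(x)\<close>; so
  on \<open>I \<inter> \<Gamma>\<^bsub>n\<^esub>\<close> the degree of \<open>g\<close> is at most \<open>d(n) + E\<close> for a constant \<open>E\<close>.  But \<open>I\<close> is also a right ideal,
  where the action is through \<open>f(x^2)\<close>: multiplying \<open>e\<^bsub>12\<^esub> \<in> I \<inter> \<Gamma>\<^bsub>k\<^esub>\<close> by elements of
  \<open>\<Gamma>\<^bsub>n\<^esub>\<close> yields \<open>2 d(n) \<le> d(k + n) + E\<close>.  As \<open>d\<close> is unbounded, it grows exponentially, a contradiction.

  Both consequences of noetherianity are instances of \<open>leading_span_stops\<close>, which holds for an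
  arbitrary filtered algebra; the contradiction is \<open>no_left_noetherian_filtration\<close>.
\<close>

section \<open>Ascending chains of subgroups of polynomials\<close>

definition acc_on :: "'a set set \<Rightarrow> bool" where
  "acc_on \<A> \<longleftrightarrow>
     (\<forall>I :: nat \<Rightarrow> 'a set. (\<forall>n. I n \<in> \<A>) \<and> (\<forall>n. I n \<subseteq> I (Suc n)) \<longrightarrow>
        (\<exists>N. \<forall>n\<ge>N. I n = I N))"

lemma acc_onD:
  assumes "acc_on \<A>" "\<And>n. I n \<in> \<A>" "\<And>n. I n \<subseteq> I (Suc n)"
  shows "\<exists>N. \<forall>n\<ge>N. I n = I N"
  using assms unfolding acc_on_def by simp

definition diff_closed :: "'a::ab_group_add set \<Rightarrow> bool" where
  "diff_closed I \<longleftrightarrow> 0 \<in> I \<and> (\<forall>p\<in>I. \<forall>q\<in>I. p - q \<in> I)"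

text \<open>Polynomials of degree below \<open>d\<close> are included and contribute the coefficient \<open>0\<close>, which makes
  \<open>lead_coeffs d I\<close> a subgroup whenever \<open>I\<close> is one.\<close>

definition lead_coeffs :: "nat \<Rightarrow> 'a::zero poly set \<Rightarrow> 'a set" where
  "lead_coeffs d I = {coeff p d | p. p \<in> I \<and> degree p \<le> d}"

lemma lead_coeffsI: "p \<in> I \<Longrightarrow> degree p \<le> d \<Longrightarrow> coeff p d = a \<Longrightarrow> a \<in> lead_coeffs d I"
  by (auto simp: lead_coeffs_def)

lemma lead_coeffsE:
  assumes "a \<in> lead_coeffs d I"
  obtains p where "p \<in> I" "degree p \<le> d" "a = coeff p d"
  using assms by (auto simp: lead_coeffs_def)

lemma diff_closed_add:
  assumes "diff_closed I" "p \<in> I" "q \<in> I" shows "p + q \<in> I"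
proof -
  have "0 - q \<in> I" using assms unfolding diff_closed_def by blast
  then have "p - (0 - q) \<in> I" using assms unfolding diff_closed_def by blast
  then show ?thesis by simp
qed

lemma diff_closed_lead_coeffs:
  assumes "diff_closed I" shows "diff_closed (lead_coeffs d I)"
  unfolding diff_closed_def
proof (intro conjI ballI)
  show "0 \<in> lead_coeffs d I"
    using assms by (force simp: lead_coeffs_def diff_closed_def intro!: exI[of _ "0::'a poly"])
  fix a b assume "a \<in> lead_coeffs d I" "b \<in> lead_coeffs d I"
  then obtain p q where "a = coeff p d" "p \<in> I" "degree p \<le> d"
      "b = coeff q d" "q \<in> I" "degree q \<le> d"
    by (auto simp: lead_coeffs_def)
  with assms show "a - b \<in> lead_coeffs d I"
    unfolding lead_coeffs_def diff_closed_def
    by (auto intro!: exI[of _ "p - q"] simp: degree_diff_le)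
qed

lemma lead_coeffs_mono: "I \<subseteq> J \<Longrightarrow> lead_coeffs d I \<subseteq> lead_coeffs d J"
  by (auto simp: lead_coeffs_def)

text \<open>Subtracting a member of \<open>I\<close> with the same leading term lowers the degree, so every member of
  \<open>J\<close> reduces to zero by members of \<open>I\<close>.\<close>

lemma eq_if_lead_coeffs_eq:
  assumes I: "diff_closed I" and J: "diff_closed J" and "I \<subseteq> J"
    and lc: "\<And>d. lead_coeffs d J \<subseteq> lead_coeffs d I"
  shows "I = J"
proof -
  have "p \<in> I" if "p \<in> J" "degree p \<le> d" for p d
    using that
  proof (induction d arbitrary: p)
    case 0
    then obtain q where q: "q \<in> I" "degree q \<le> 0" "coeff q 0 = coeff p 0"
      using lc[of 0] by (auto simp: lead_coeffs_def)
    then have "p = q" using 0 by (metis le_zero_eq degree_eq_zeroE coeff_pCons_0)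
    with q show ?case by simp
  next
    case (Suc d)
    then obtain q where q: "q \<in> I" "degree q \<le> Suc d" "coeff q (Suc d) = coeff p (Suc d)"
      using lc[of "Suc d"] by (auto simp: lead_coeffs_def)
    have "p - q \<in> J" using J Suc.prems q \<open>I \<subseteq> J\<close> unfolding diff_closed_def by blast
    moreover have "degree (p - q) \<le> d"
    proof (rule degree_le, intro allI impI)
      fix i assume "d < i"
      then show "coeff (p - q) i = 0"
        using q Suc.prems by (cases "i = Suc d") (auto simp: coeff_eq_0)
    qed
    ultimately have "p - q \<in> I" by (rule Suc.IH)
    from diff_closed_add[OF I this q(1)] show ?case by simp
  qed
  with \<open>I \<subseteq> J\<close> show ?thesis by blast
qed

lemma mono_chain: "(\<And>n. I n \<subseteq> I (Suc n)) \<Longrightarrow> m \<le> n \<Longrightarrow> I m \<subseteq> (I n :: 'a set)"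
  by (rule lift_Suc_mono_le)

lemma uniform_stop_finite:
  fixes L :: "nat \<Rightarrow> 'i \<Rightarrow> 'b"
  assumes "finite D" and "\<And>d. d \<in> D \<Longrightarrow> \<exists>N. \<forall>n\<ge>N. L n d = L N d"
  shows "\<exists>N. \<forall>n\<ge>N. \<forall>d\<in>D. L n d = L N d"
proof -
  obtain f where f: "\<And>d n. d \<in> D \<Longrightarrow> n \<ge> f d \<Longrightarrow> L n d = L (f d) d"
    using assms(2) by metis
  obtain N where "\<forall>d\<in>D. f d \<le> N"
    using finite_nat_set_iff_bounded_le[of "f ` D"] assms(1) by auto
  then show ?thesis using f by (metis order_trans)
qed

text \<open>Beyond the place \<open>N\<close> where the diagonal stops, all entries agree with \<open>L N N\<close>.  That leaves the
  finitely many columns \<open>d < N\<close>, each of which stops by itself.\<close>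

lemma uniform_stop_double:
  fixes L :: "nat \<Rightarrow> nat \<Rightarrow> 'a set"
  assumes acc: "acc_on \<A>" and mem: "\<And>n d. L n d \<in> \<A>"
    and mono1: "\<And>n d. L n d \<subseteq> L (Suc n) d" and mono2: "\<And>n d. L n d \<subseteq> L n (Suc d)"
  shows "\<exists>N. \<forall>n\<ge>N. \<forall>d. L n d = L N d"
proof -
  have mono: "L m c \<subseteq> L n d" if "m \<le> n" "c \<le> d" for m n c d
    using mono_chain[of "\<lambda>n. L n c", OF mono1 that(1)] mono_chain[of "L n", OF mono2 that(2)]
    by blast
  have "L n n \<subseteq> L (Suc n) (Suc n)" for n by (intro mono) auto
  then obtain N where N: "\<And>n. n \<ge> N \<Longrightarrow> L n n = L N N"
    using acc_onD[OF acc, of "\<lambda>n. L n n", OF mem] by blast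
  have large: "L n d = L N N" if "n \<ge> N" "d \<ge> N" for n d
    using mono[of N n N d] mono[of n "max n d" d "max n d"] N[of "max n d"] that by auto
  have stop: "\<exists>M. \<forall>n\<ge>M. L n d = L M d" for d
    by (rule acc_onD[OF acc]) (fact mem mono1)+
  obtain M where M: "\<forall>n\<ge>M. \<forall>d\<in>{..<N}. L n d = L M d"
    using uniform_stop_finite[of "{..<N}" L, OF finite_lessThan stop] by (elim exE)
  have "L n d = L (max M N) d" if "n \<ge> max M N" for n d
  proof (cases "d < N")
    case True
    then show ?thesis
      using M[rule_format, of n d] M[rule_format, of "max M N" d] that by simp
  next
    case False
    then show ?thesis
      using large[of n d] large[of "max M N" d] that by simp
  qed
  then show ?thesis by blast
qed

text \<open>Hilbert's basis argument.  Multiplication by \<open>X^e\<close> compares leading coefficients only between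
  degrees that agree modulo \<open>e\<close>, so the double chain argument is applied to each residue class.
  The case \<open>e = 2\<close> says that \<open>k[x]\<close> is noetherian over \<open>k[x^2]\<close>.\<close>

lemma acc_on_poly:
  fixes \<A> :: "'a::comm_ring_1 set set"
  assumes acc: "acc_on \<A>" and e: "e > 0"
  shows "acc_on {I. diff_closed I \<and> (\<forall>p\<in>I. monom 1 e * p \<in> I) \<and> (\<forall>d. lead_coeffs d I \<in> \<A>)}"
  unfolding acc_on_def
proof (intro allI impI, elim conjE)
  fix I :: "nat \<Rightarrow> 'a::comm_ring_1 poly set"
  assume mem: "\<forall>n. I n \<in> {I. diff_closed I \<and> (\<forall>p\<in>I. monom 1 e * p \<in> I) \<and> (\<forall>d. lead_coeffs d I \<in> \<A>)}"
    and asc: "\<forall>n. I n \<subseteq> I (Suc n)"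
  define L where "L r n q = lead_coeffs (r + q * e) (I n)" for r n q
  have stop: "\<exists>N. \<forall>n\<ge>N. L r n = L r N" for r
    unfolding fun_eq_iff
  proof (rule uniform_stop_double[OF acc])
    show "L r n q \<in> \<A>" for n q using mem by (auto simp: L_def)
    show "L r n q \<subseteq> L r (Suc n) q" for n q using asc by (simp add: L_def lead_coeffs_mono)
    show "L r n q \<subseteq> L r n (Suc q)" for n q
    proof
      fix a assume "a \<in> L r n q"
      then obtain p where p: "a = coeff p (r + q * e)" "p \<in> I n" "degree p \<le> r + q * e"
        by (auto simp: L_def lead_coeffs_def)
      have "monom 1 e * p \<in> I n" using mem p by auto
      moreover have "degree (monom 1 e * p) \<le> r + Suc q * e"
        using degree_mult_le[of "monom 1 e" p] degree_monom_le[of "1::'a" e] p by simp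
      moreover have "coeff (monom 1 e * p) (r + Suc q * e) = a"
        using p by (simp add: coeff_monom_mult)
      ultimately show "a \<in> L r n (Suc q)" unfolding L_def by (rule lead_coeffsI)
    qed
  qed
  obtain N where N: "\<forall>n\<ge>N. \<forall>r\<in>{..<e}. L r n = L r N"
    using uniform_stop_finite[of "{..<e}" "\<lambda>n r. L r n", OF finite_lessThan stop] by (elim exE)
  have lc: "lead_coeffs d (I n) = lead_coeffs d (I N)" if "n \<ge> N" for n d
  proof -
    have "L (d mod e) n (d div e) = L (d mod e) N (d div e)"
      using N[rule_format, OF that, of "d mod e"] e by simp
    then show ?thesis by (simp add: L_def)
  qed
  have "I n = I N" if "n \<ge> N" for n
    using eq_if_lead_coeffs_eq[of "I N" "I n"] mem lc[OF that, THEN equalityD1]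
      mono_chain[of I N n] asc that by blast
  then show "\<exists>N. \<forall>n\<ge>N. I n = I N" by blast
qed

lemma acc_on_subset: "acc_on \<B> \<Longrightarrow> \<A> \<subseteq> \<B> \<Longrightarrow> acc_on \<A>"
  unfolding acc_on_def by (metis (no_types, lifting) subsetD)

lemma acc_on_subspaces_field:
  "acc_on {I :: 'k::field set. diff_closed I \<and> (\<forall>c. \<forall>p\<in>I. c * p \<in> I)}"
  unfolding acc_on_def
proof (intro allI impI, elim conjE)
  fix I :: "nat \<Rightarrow> 'k set"
  assume mem: "\<forall>n. I n \<in> {I. diff_closed I \<and> (\<forall>c. \<forall>p\<in>I. c * p \<in> I)}"
    and asc: "\<forall>n. I n \<subseteq> I (Suc n)"
  have *: "I n = {0} \<or> I n = UNIV" for n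
  proof (cases "\<exists>p\<in>I n. p \<noteq> 0")
    case True
    then obtain p where p: "p \<in> I n" "p \<noteq> 0" by blast
    have "c \<in> I n" for c
    proof -
      have "(c / p) * p \<in> I n" using mem p by blast
      with p show ?thesis by simp
    qed
    then show ?thesis by blast
  next
    case False
    then show ?thesis using mem by (auto simp: diff_closed_def)
  qed
  show "\<exists>N. \<forall>n\<ge>N. I n = I N"
  proof (cases "\<exists>N. I N = UNIV")
    case True
    then obtain N where "I N = UNIV" by blast
    then have "\<forall>n\<ge>N. I n = UNIV" using mono_chain[of I N] asc by blast
    with \<open>I N = UNIV\<close> show ?thesis by auto
  next
    case False
    with * show ?thesis by auto
  qed
qed

lemma acc_on_poly_square:
  "acc_on {I :: 'k::field poly set. diff_closed I \<and> (\<forall>p\<in>I. monom 1 2 * p \<in> I) \<and>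
     (\<forall>c. \<forall>p\<in>I. [:c:] * p \<in> I)}" (is "acc_on ?A")
proof (rule acc_on_subset[OF acc_on_poly[OF acc_on_subspaces_field, of 2]])
  show "?A \<subseteq> {I. diff_closed I \<and> (\<forall>p\<in>I. monom 1 2 * p \<in> I) \<and> (\<forall>d. lead_coeffs d I \<in>
      {I. diff_closed I \<and> (\<forall>c. \<forall>p\<in>I. c * p \<in> I)})}"
  proof safe
    fix I :: "'k poly set" and d c x
    assume I: "diff_closed I" "\<forall>c. \<forall>p\<in>I. [:c:] * p \<in> I"
    show "diff_closed (lead_coeffs d I)" using I(1) by (rule diff_closed_lead_coeffs)
    assume "x \<in> lead_coeffs d I"
    then obtain p where p: "x = coeff p d" "p \<in> I" "degree p \<le> d"
      by (elim lead_coeffsE)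
    with I have "[:c:] * p \<in> I" "degree ([:c:] * p) \<le> d" "coeff ([:c:] * p) d = c * x"
      by (auto intro: order_trans[OF degree_smult_le])
    then show "c * x \<in> lead_coeffs d I" by (rule lead_coeffsI)
  qed
qed simp

text \<open>Algebra generators of \<open>k[x^2, y]\<close>, together with the constants.\<close>

definition xsq_y_multipliers :: "'k::field poly poly set" where
  "xsq_y_multipliers = insert [:0, 1:] (insert [:monom 1 2:] (range (\<lambda>c. [:[:c:]:])))"

lemma acc_on_poly_poly:
  "acc_on {I :: 'k::field poly poly set. diff_closed I \<and> (\<forall>m\<in>xsq_y_multipliers. \<forall>p\<in>I. m * p \<in> I)}"
  (is "acc_on ?A")
proof (rule acc_on_subset[OF acc_on_poly[OF acc_on_poly_square, of 1]])
  show "?A \<subseteq> {I. diff_closed I \<and> (\<forall>p\<in>I. monom 1 1 * p \<in> I) \<and> (\<forall>d. lead_coeffs d I \<in>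
      {I. diff_closed I \<and> (\<forall>p\<in>I. monom 1 2 * p \<in> I) \<and> (\<forall>c. \<forall>p\<in>I. [:c:] * p \<in> I)})}"
  proof
    fix I :: "'k poly poly set" assume I: "I \<in> ?A"
    have step: "m * x \<in> lead_coeffs d I" if m: "[:m:] \<in> xsq_y_multipliers" and x: "x \<in> lead_coeffs d I" for m x d
    proof -
      obtain p where p: "x = coeff p d" "p \<in> I" "degree p \<le> d"
        using x by (elim lead_coeffsE)
      with I m have "[:m:] * p \<in> I" "degree ([:m:] * p) \<le> d" "coeff ([:m:] * p) d = m * x"
        by (auto intro: order_trans[OF degree_smult_le])
      then show ?thesis by (rule lead_coeffsI)
    qed
    have y: "monom 1 1 = [:0, 1 :: 'k poly:]" by (simp add: monom_altdef)
    show "I \<in> {I. diff_closed I \<and> (\<forall>p\<in>I. monom 1 1 * p \<in> I) \<and> (\<forall>d. lead_coeffs d I \<in>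
      {I. diff_closed I \<and> (\<forall>p\<in>I. monom 1 2 * p \<in> I) \<and> (\<forall>c. \<forall>p\<in>I. [:c:] * p \<in> I)})}"
    proof (intro CollectI conjI allI ballI)
      show "diff_closed I" "diff_closed (lead_coeffs d I)" for d
        using I by (simp_all add: diff_closed_lead_coeffs)
      show "monom 1 1 * p \<in> I" if "p \<in> I" for p
        unfolding y using I that by (simp add: xsq_y_multipliers_def)
      show "monom 1 2 * x \<in> lead_coeffs d I" "[:c:] * x \<in> lead_coeffs d I"
        if "x \<in> lead_coeffs d I" for c d x
        using that by (auto intro!: step simp: xsq_y_multipliers_def simp del: mult_pCons_left)
    qed
  qed
qed simp

text \<open>Reading a matrix as a polynomial of degree at most \<open>3\<close> makes the leading coefficient argument
  handle its four entries one after the other: \<open>lead_coeffs d\<close> is then the set of \<open>d\<close>-th entries of the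
  members whose later entries vanish.\<close>

definition entries_poly :: "'a::zero mat \<Rightarrow> 'a poly" where
  "entries_poly s = [:s $$ (0,0), s $$ (0,1), s $$ (1,0), s $$ (1,1):]"

lemma coeff_entries_poly:
  "coeff (entries_poly s) d = (if d < 4 then s $$ (d div 2, d mod 2) else 0)"
proof (cases "d < 4")
  case True
  then have "d \<in> {0, 1, 2, 3}" by auto
  moreover have "coeff (entries_poly s) 0 = s $$ (0, 0)" "coeff (entries_poly s) 1 = s $$ (0, 1)"
      "coeff (entries_poly s) 2 = s $$ (1, 0)" "coeff (entries_poly s) 3 = s $$ (1, 1)"
    by (simp_all add: entries_poly_def numeral_eq_Suc)
  ultimately show ?thesis by (elim insertE) simp_all
next
  case False
  then obtain e where "d = 4 + e" using le_Suc_ex[of 4 d] by auto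
  then show ?thesis by (simp add: entries_poly_def numeral_eq_Suc)
qed

lemma inj_on_entries_poly: "inj_on entries_poly (carrier_mat 2 2)"
proof (rule inj_onI, rule eq_matI)
  fix s t :: "'a mat" and i j
  assume st: "s \<in> carrier_mat 2 2" "t \<in> carrier_mat 2 2" "entries_poly s = entries_poly t"
    "i < dim_row t" "j < dim_col t"
  then have "i = 0 \<or> i = 1" "j = 0 \<or> j = 1" by auto
  with st(3) show "s $$ (i, j) = t $$ (i, j)" by (auto simp: entries_poly_def)
qed auto

text \<open>The multiplier need act correctly on the entry \<open>(i, j)\<close> only and may treat the others in any way
  that keeps zeros.  This is what \<open>S\<close> can offer: \<open>diag(x, x^2)\<close> multiplies the second row by \<open>x^2\<close>,
  and its square does so for the first row, but no diagonal matrix over \<open>k[x]\<close> in \<open>S\<close> does both.\<close>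

lemma matrix_chain_stops:
  fixes I :: "nat \<Rightarrow> 'k::field poly poly mat set"
  assumes carr: "\<And>n. I n \<subseteq> carrier_mat 2 2" and zero: "\<And>n. 0\<^sub>m 2 2 \<in> I n"
    and diff: "\<And>n s t. s \<in> I n \<Longrightarrow> t \<in> I n \<Longrightarrow> s - t \<in> I n"
    and asc: "\<And>n. I n \<subseteq> I (Suc n)"
    and mult: "\<And>n s m i j. \<lbrakk>s \<in> I n; m \<in> xsq_y_multipliers; i < 2; j < 2\<rbrakk> \<Longrightarrow>
       \<exists>t\<in>I n. t $$ (i, j) = m * s $$ (i, j) \<and>
         (\<forall>i'<2. \<forall>j'<2. s $$ (i', j') = 0 \<longrightarrow> t $$ (i', j') = 0)"
  shows "\<exists>N. \<forall>n\<ge>N. I n = I N"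
proof -
  define J where "J n = entries_poly ` I n" for n
  have J: "diff_closed (J n)" for n
    unfolding diff_closed_def
  proof (intro conjI ballI)
    show "0 \<in> J n" unfolding J_def
      by (rule image_eqI[OF _ zero]) (simp add: entries_poly_def)
    fix p q assume "p \<in> J n" "q \<in> J n"
    then obtain s t where st: "s \<in> I n" "t \<in> I n" "p = entries_poly s" "q = entries_poly t"
      by (auto simp: J_def)
    then have "entries_poly (s - t) = p - q"
      using carr[of n] by (auto simp: entries_poly_def)
    then show "p - q \<in> J n" using diff[OF st(1,2)] by (auto simp: J_def intro: rev_image_eqI)
  qed
  let ?A = "{I :: 'k poly poly set. diff_closed I \<and> (\<forall>m\<in>xsq_y_multipliers. \<forall>p\<in>I. m * p \<in> I)}"
  have lc: "lead_coeffs d (J n) \<in> ?A" if d: "d < 4" for d n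
  proof safe
    show "diff_closed (lead_coeffs d (J n))" using J by (rule diff_closed_lead_coeffs)
    fix m x :: "'k poly poly" assume m: "m \<in> xsq_y_multipliers" and "x \<in> lead_coeffs d (J n)"
    then obtain s where s: "s \<in> I n" "degree (entries_poly s) \<le> d" "x = coeff (entries_poly s) d"
      by (auto simp: lead_coeffs_def J_def)
    obtain t where t: "t \<in> I n" "t $$ (d div 2, d mod 2) = m * s $$ (d div 2, d mod 2)"
        "\<forall>i'<2. \<forall>j'<2. s $$ (i', j') = 0 \<longrightarrow> t $$ (i', j') = 0"
      using mult[OF s(1) m, of "d div 2" "d mod 2"] d by force
    have "degree (entries_poly t) \<le> d"
    proof (rule degree_le, intro allI impI)
      fix i assume "d < i"
      then have "coeff (entries_poly s) i = 0" using s(2) by (simp add: coeff_eq_0)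
      then show "coeff (entries_poly t) i = 0"
        using t(3) by (auto simp: coeff_entries_poly split: if_splits)
    qed
    moreover have "coeff (entries_poly t) d = m * x" using t(2) s(3) d by (simp add: coeff_entries_poly)
    ultimately show "m * x \<in> lead_coeffs d (J n)"
      using t(1) by (auto simp: J_def intro!: lead_coeffsI[of "entries_poly t"])
  qed
  have stop: "\<exists>N. \<forall>n\<ge>N. lead_coeffs d (J n) = lead_coeffs d (J N)" if "d < 4" for d
  proof -
    have "\<forall>n. lead_coeffs d (J n) \<subseteq> lead_coeffs d (J (Suc n))"
      using asc by (auto simp: J_def intro!: lead_coeffs_mono image_mono)
    then show ?thesis
      using acc_onD[OF acc_on_poly_poly, of "\<lambda>n. lead_coeffs d (J n)"] lc[of d] that by auto
  qed
  obtain N where N: "\<forall>n\<ge>N. \<forall>d\<in>{..<4}. lead_coeffs d (J n) = lead_coeffs d (J N)"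
    using uniform_stop_finite[of "{..<4}" "\<lambda>n d. lead_coeffs d (J n)", OF finite_lessThan] stop
    by auto
  have large: "lead_coeffs d (J n) = {0}" if "\<not> d < 4" for d n
  proof -
    have "a = 0" if "a \<in> lead_coeffs d (J n)" for a
      using that \<open>\<not> d < 4\<close> by (elim lead_coeffsE) (auto simp: J_def coeff_entries_poly)
    moreover have "0 \<in> lead_coeffs d (J n)"
      using diff_closed_lead_coeffs[OF J[of n], of d] by (simp add: diff_closed_def)
    ultimately show ?thesis by blast
  qed
  have "I n = I N" if "n \<ge> N" for n
  proof -
    have "I N \<subseteq> I n" using mono_chain[of I N n] asc that by blast
    then have "J N \<subseteq> J n" by (auto simp: J_def)
    moreover have "lead_coeffs d (J n) \<subseteq> lead_coeffs d (J N)" for d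
      using N[rule_format, OF that, of d] large[of d] by (cases "d < 4") simp_all
    ultimately have "J N = J n" by (intro eq_if_lead_coeffs_eq J)
    then show ?thesis
      using inj_on_image_eq_iff[OF inj_on_entries_poly carr[of N] carr[of n]] by (simp add: J_def)
  qed
  then show ?thesis by blast
qed

section \<open>Leading terms in filtered algebras\<close>

text \<open>\<open>\<Gamma>\<^bsub>n-1\<^esub> + \<Sum>\<^bsub>d\<le>min M n\<^esub> \<Gamma>\<^bsub>n-d\<^esub> J\<^bsub>d\<^esub>\<close>: the elements of \<open>\<Gamma>\<^bsub>n\<^esub>\<close> whose classes lie in the left
  ideal of the associated graded ring generated by the classes of \<open>J\<^bsub>0\<^esub>, \<dots>, J\<^bsub>M\<^esub>\<close>.\<close>

inductive_set leading_span ::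
    "('a, 'b) ring_scheme \<Rightarrow> (nat \<Rightarrow> 'a set) \<Rightarrow> (nat \<Rightarrow> 'a set) \<Rightarrow> nat \<Rightarrow> nat \<Rightarrow> 'a set"
  for A and \<Gamma> and J and M and n where
    lower: "a \<in> filt_pred A \<Gamma> n \<Longrightarrow> a \<in> leading_span A \<Gamma> J M n"
  | prod: "\<lbrakk> d \<le> M; d \<le> n; a \<in> \<Gamma> (n - d); b \<in> J d \<rbrakk> \<Longrightarrow> a \<otimes>\<^bsub>A\<^esub> b \<in> leading_span A \<Gamma> J M n"
  | add: "\<lbrakk> a \<in> leading_span A \<Gamma> J M n; b \<in> leading_span A \<Gamma> J M n \<rbrakk> \<Longrightarrow>
      a \<oplus>\<^bsub>A\<^esub> b \<in> leading_span A \<Gamma> J M n"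

context N_filtration
begin

lemma filt_carrier: "a \<in> \<Gamma> i \<Longrightarrow> a \<in> carrier A"
  using exhaustive by blast

lemma filt_zero: "\<zero> \<in> \<Gamma> i"
  using subgroup.one_closed[OF subalgebra.axioms(1)[OF subspace]] by simp

lemma filt_add: "a \<in> \<Gamma> i \<Longrightarrow> b \<in> \<Gamma> i \<Longrightarrow> a \<oplus> b \<in> \<Gamma> i"
  using subgroup.m_closed[OF subalgebra.axioms(1)[OF subspace]] by simp

lemma filt_neg: "a \<in> \<Gamma> i \<Longrightarrow> \<ominus> a \<in> \<Gamma> i"
  using subgroup.m_inv_closed[OF subalgebra.axioms(1)[OF subspace]] by (simp add: a_inv_def)

lemma filt_mono: "i \<le> j \<Longrightarrow> \<Gamma> i \<subseteq> \<Gamma> j"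
  by (rule lift_Suc_mono_le[of \<Gamma>, OF ascending])

abbreviation pre :: "nat \<Rightarrow> 'a set" where "pre n \<equiv> filt_pred A \<Gamma> n"

lemma pre_subset: "pre n \<subseteq> \<Gamma> n"
  using filt_zero ascending by (auto simp: filt_pred_def split: nat.splits)

lemma pre_carrier: "a \<in> pre n \<Longrightarrow> a \<in> carrier A"
  using pre_subset filt_carrier by blast

lemma pre_zero: "\<zero> \<in> pre n"
  using filt_zero by (auto simp: filt_pred_def split: nat.splits)

lemma pre_add: "a \<in> pre n \<Longrightarrow> b \<in> pre n \<Longrightarrow> a \<oplus> b \<in> pre n"
  using filt_add by (auto simp: filt_pred_def split: nat.splits)

lemma pre_neg: "a \<in> pre n \<Longrightarrow> \<ominus> a \<in> pre n"
  using filt_neg by (auto simp: filt_pred_def split: nat.splits)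

lemma pre_mult_left: "a \<in> \<Gamma> i \<Longrightarrow> b \<in> pre j \<Longrightarrow> a \<otimes> b \<in> pre (i + j)"
  using mult_in[of a i b] filt_carrier pre_zero[of i]
  by (auto simp: filt_pred_def split: nat.splits)

lemma pre_mult_right: "a \<in> pre i \<Longrightarrow> b \<in> \<Gamma> j \<Longrightarrow> a \<otimes> b \<in> pre (i + j)"
  using mult_in[of a _ b j] filt_carrier pre_zero[of j]
  by (auto simp: filt_pred_def split: nat.splits)

lemma mem_coset: "x \<in> pre n +> a \<longleftrightarrow> (\<exists>p\<in>pre n. x = p \<oplus> a)"
  by (auto simp: a_r_coset_def')

lemma pre_additive_subgroup: "additive_subgroup (pre n) A"
proof (intro additive_subgroup.intro add.subgroupI)
  show "pre n \<noteq> {}" using pre_zero by blast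
qed (use pre_carrier pre_add pre_neg in \<open>auto simp: a_inv_def\<close>)

lemma pre_abelian_subgroup: "abelian_subgroup (pre n) A"
  by (rule abelian_subgroupI3[OF pre_additive_subgroup abelian_group_axioms])

lemma coset_eqI: "x \<in> pre n +> a \<Longrightarrow> a \<in> carrier A \<Longrightarrow> pre n +> x = pre n +> a"
  by (metis abelian_subgroup.a_repr_independence' pre_abelian_subgroup)

lemma coset_self: "a \<in> carrier A \<Longrightarrow> a \<in> pre n +> a"
  unfolding mem_coset using pre_zero by force

lemma coset_of_pre: "a \<in> pre n \<Longrightarrow> pre n +> a = pre n"
  using abelian_subgroup.a_rcos_const[OF pre_abelian_subgroup] by blast

lemma coset_add:
  "a \<in> carrier A \<Longrightarrow> b \<in> carrier A \<Longrightarrow> (pre n +> a) <+> (pre n +> b) = pre n +> (a \<oplus> b)"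
  using abelian_subgroup.a_rcos_sum[OF pre_abelian_subgroup] by blast

text \<open>Replacing representatives changes the product by terms in \<open>\<Gamma>\<^bsub>i-1\<^esub> \<Gamma>\<^bsub>j\<^esub> + \<Gamma>\<^bsub>i\<^esub> \<Gamma>\<^bsub>j-1\<^esub>\<close>, hence in
  \<open>\<Gamma>\<^bsub>i+j-1\<^esub>\<close>.\<close>

lemma coset_mult:
  assumes a: "a \<in> \<Gamma> i" and b: "b \<in> \<Gamma> j"
  shows "rcoset_mult A (pre (i + j)) (pre i +> a) (pre j +> b) = pre (i + j) +> (a \<otimes> b)"
proof -
  have eq: "pre (i + j) +> (x \<otimes> y) = pre (i + j) +> (a \<otimes> b)"
    if xy: "x \<in> pre i +> a" "y \<in> pre j +> b" for x y
  proof (rule coset_eqI)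
    obtain p q where pq: "p \<in> pre i" "x = p \<oplus> a" "q \<in> pre j" "y = q \<oplus> b"
      using xy by (auto simp: mem_coset)
    have y: "y \<in> \<Gamma> j" using pq pre_subset b filt_add by blast
    have "x \<otimes> y = (p \<otimes> y \<oplus> a \<otimes> q) \<oplus> a \<otimes> b"
    proof -
      have "a \<in> carrier A" "b \<in> carrier A" "p \<in> carrier A" "q \<in> carrier A"
        using pq a b filt_carrier pre_carrier by blast+
      then show ?thesis unfolding pq by (simp add: l_distr r_distr a_ac)
    qed
    moreover have "p \<otimes> y \<oplus> a \<otimes> q \<in> pre (i + j)"
      using pq a y by (intro pre_add pre_mult_left pre_mult_right)
    ultimately show "x \<otimes> y \<in> pre (i + j) +> (a \<otimes> b)" unfolding mem_coset by blast
    show "a \<otimes> b \<in> carrier A" using a b filt_carrier by blast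
  qed
  have "a \<in> pre i +> a" "b \<in> pre j +> b" using a b filt_carrier coset_self by blast+
  with eq show ?thesis unfolding rcoset_mult_def by blast
qed

lemma filt_abelian_group: "abelian_group (A\<lparr>carrier := \<Gamma> n\<rparr>)"
proof (rule abelian_groupI)
  fix x assume "x \<in> carrier (A\<lparr>carrier := \<Gamma> n\<rparr>)"
  then show "\<exists>y\<in>carrier (A\<lparr>carrier := \<Gamma> n\<rparr>). y \<oplus>\<^bsub>A\<lparr>carrier := \<Gamma> n\<rparr>\<^esub> x = \<zero>\<^bsub>A\<lparr>carrier := \<Gamma> n\<rparr>\<^esub>"
    using filt_neg[of x n] filt_carrier[of x n] l_neg by auto
qed (use filt_add filt_zero filt_carrier a_assoc a_comm in auto)

lemma gr_component_abelian_subgroup: "abelian_subgroup (pre n) (A\<lparr>carrier := \<Gamma> n\<rparr>)"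
proof (rule abelian_subgroupI3[OF _ filt_abelian_group])
  have "subgroup (pre n) (add_monoid (A\<lparr>carrier := \<Gamma> n\<rparr>))"
    using add.subgroup_incl[OF additive_subgroup.a_subgroup[OF pre_additive_subgroup]
        subalgebra.axioms(1)[OF subspace] pre_subset] by simp
  then show "additive_subgroup (pre n) (A\<lparr>carrier := \<Gamma> n\<rparr>)"
    by (rule additive_subgroup.intro)
qed

lemma gr_component_comm_group: "comm_group (gr_component A \<Gamma> n)"
  unfolding gr_component_def
  by (rule abelian_subgroup.a_factorgroup_is_comm_group[OF gr_component_abelian_subgroup])

lemma gr_component_group: "group (gr_component A \<Gamma> n)"
  using gr_component_comm_group by (rule comm_group.axioms)

lemma gr_component_carrier: "carrier (gr_component A \<Gamma> n) = {pre n +> a | a. a \<in> \<Gamma> n}"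
  by (auto simp: gr_component_def A_FactGroup_def' A_RCOSETS_def' a_r_coset_def')

lemma gr_component_one: "\<one>\<^bsub>gr_component A \<Gamma> n\<^esub> = pre n"
  by (simp add: gr_component_def A_FactGroup_def')

lemma gr_component_mult: "X \<otimes>\<^bsub>gr_component A \<Gamma> n\<^esub> Y = X <+> Y"
  by (simp add: gr_component_def set_add_def')

lemma gr_component_inv:
  assumes "a \<in> \<Gamma> n"
  shows "inv\<^bsub>gr_component A \<Gamma> n\<^esub> (pre n +> a) = pre n +> (\<ominus> a)"
proof (rule group.inv_equality[OF gr_component_group])
  show "(pre n +> \<ominus> a) \<otimes>\<^bsub>gr_component A \<Gamma> n\<^esub> (pre n +> a) = \<one>\<^bsub>gr_component A \<Gamma> n\<^esub>"
    using assms filt_carrier pre_zero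
    by (simp add: gr_component_mult gr_component_one coset_add l_neg coset_of_pre)
qed (use assms filt_neg in \<open>auto simp: gr_component_carrier\<close>)

lemma gr_carrier:
  "carrier (gr A \<Gamma>) = {F. (\<forall>n. F n \<in> carrier (gr_component A \<Gamma> n)) \<and> finite {n. F n \<noteq> pre n}}"
  by (simp add: gr_def carrier_sum_group gr_component_group gr_component_one PiE_iff)

lemma gr_mult:
  "(F \<otimes>\<^bsub>gr A \<Gamma>\<^esub> G) n = (\<Otimes>\<^bsub>gr_component A \<Gamma> n\<^esub> i \<in> {..n}. rcoset_mult A (pre n) (F i) (G (n - i)))"
  by (simp add: gr_def)

lemma leading_span_filt:
  assumes "\<And>d. J d \<subseteq> \<Gamma> d" and "x \<in> leading_span A \<Gamma> J M n"
  shows "x \<in> \<Gamma> n"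
  using assms(2)
proof induction
  case (prod d a b)
  then show ?case using mult_in[of a "n - d" b d] assms(1) by auto
qed (use pre_subset filt_add in auto)

lemma leading_span_neg:
  assumes J: "\<And>d. J d \<subseteq> \<Gamma> d" and "x \<in> leading_span A \<Gamma> J M n"
  shows "\<ominus> x \<in> leading_span A \<Gamma> J M n"
  using assms(2)
proof induction
  case (lower a)
  then show ?case by (simp add: pre_neg leading_span.lower)
next
  case (prod d a b)
  then have "\<ominus> a \<otimes> b \<in> leading_span A \<Gamma> J M n" by (intro leading_span.prod filt_neg)
  moreover have "a \<in> carrier A" "b \<in> carrier A" using prod J filt_carrier by blast+
  ultimately show ?case by (simp add: l_minus)
next
  case (add a b)
  moreover have "a \<in> carrier A" "b \<in> carrier A"
    using add leading_span_filt[OF J] filt_carrier by blast+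
  ultimately show ?case by (simp add: minus_add leading_span.add)
qed

lemma leading_span_mult:
  assumes J: "\<And>d. J d \<subseteq> \<Gamma> d" and a: "a \<in> \<Gamma> i" and "x \<in> leading_span A \<Gamma> J M n"
  shows "a \<otimes> x \<in> leading_span A \<Gamma> J M (i + n)"
  using assms(3)
proof induction
  case (lower x)
  with a show ?case by (simp add: pre_mult_left leading_span.lower)
next
  case (prod d c b)
  then have "(a \<otimes> c) \<otimes> b \<in> leading_span A \<Gamma> J M (i + n)"
    using mult_in[OF a, of c "n - d"] by (intro leading_span.prod) auto
  moreover have "a \<in> carrier A" "b \<in> carrier A" "c \<in> carrier A" using prod J a filt_carrier by blast+
  ultimately show ?case by (simp add: m_assoc)
next
  case (add x y)
  moreover have "a \<in> carrier A" "x \<in> carrier A" "y \<in> carrier A"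
    using add leading_span_filt[OF J] a filt_carrier by blast+
  ultimately show ?case by (simp add: r_distr leading_span.add)
qed

lemma leading_span_coset:
  assumes J: "\<And>d. J d \<subseteq> \<Gamma> d" and a: "a \<in> \<Gamma> n"
  shows "pre n +> a \<subseteq> leading_span A \<Gamma> J M n \<longleftrightarrow> a \<in> leading_span A \<Gamma> J M n"
proof
  assume "pre n +> a \<subseteq> leading_span A \<Gamma> J M n"
  then show "a \<in> leading_span A \<Gamma> J M n"
    using coset_self[OF filt_carrier[OF a], of n] by blast
next
  assume "a \<in> leading_span A \<Gamma> J M n"
  then show "pre n +> a \<subseteq> leading_span A \<Gamma> J M n"
    unfolding subset_iff mem_coset by (metis leading_span.add leading_span.lower)
qed

text \<open>A homogeneous component is a coset of \<open>\<Gamma>\<^bsub>n-1\<^esub>\<close>, and \<open>leading_span\<close> contains \<open>\<Gamma>\<^bsub>n-1\<^esub>\<close>; so inclusion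
  of sets expresses membership of the class.\<close>

definition leading_ideal :: "(nat \<Rightarrow> 'a set) \<Rightarrow> nat \<Rightarrow> (nat \<Rightarrow> 'a set) set" where
  "leading_ideal J M = {F \<in> carrier (gr A \<Gamma>). \<forall>n. F n \<subseteq> leading_span A \<Gamma> J M n}"

lemma leading_ideal_iff:
  assumes J: "\<And>d. J d \<subseteq> \<Gamma> d"
  shows "F \<in> leading_ideal J M \<longleftrightarrow>
    (\<forall>n. \<exists>a\<in>\<Gamma> n. F n = pre n +> a \<and> a \<in> leading_span A \<Gamma> J M n) \<and> finite {n. F n \<noteq> pre n}"
proof
  assume F: "F \<in> leading_ideal J M"
  have "\<exists>a\<in>\<Gamma> n. F n = pre n +> a \<and> a \<in> leading_span A \<Gamma> J M n" for n
  proof -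
    have "F n \<in> carrier (gr_component A \<Gamma> n)" "F n \<subseteq> leading_span A \<Gamma> J M n"
      using F by (simp_all add: leading_ideal_def gr_carrier)
    then obtain a where a: "a \<in> \<Gamma> n" "F n = pre n +> a" "pre n +> a \<subseteq> leading_span A \<Gamma> J M n"
      by (auto simp: gr_component_carrier)
    then show ?thesis using leading_span_coset[OF J a(1)] by blast
  qed
  then show "(\<forall>n. \<exists>a\<in>\<Gamma> n. F n = pre n +> a \<and> a \<in> leading_span A \<Gamma> J M n) \<and> finite {n. F n \<noteq> pre n}"
    using F by (simp add: leading_ideal_def gr_carrier)
next
  assume F: "(\<forall>n. \<exists>a\<in>\<Gamma> n. F n = pre n +> a \<and> a \<in> leading_span A \<Gamma> J M n) \<and> finite {n. F n \<noteq> pre n}"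
  have "F n \<in> carrier (gr_component A \<Gamma> n) \<and> F n \<subseteq> leading_span A \<Gamma> J M n" for n
  proof -
    obtain a where a: "a \<in> \<Gamma> n" "F n = pre n +> a" "a \<in> leading_span A \<Gamma> J M n"
      using F by blast
    then show ?thesis using leading_span_coset[OF J a(1)] by (auto simp: gr_component_carrier)
  qed
  with F show "F \<in> leading_ideal J M" by (simp add: leading_ideal_def gr_carrier)
qed

lemma gr_add: "F \<oplus>\<^bsub>gr A \<Gamma>\<^esub> G = (\<lambda>n. F n <+> G n)"
  by (simp add: gr_def gr_component_mult restrict_UNIV)

lemma gr_zero: "\<zero>\<^bsub>gr A \<Gamma>\<^esub> = pre"
  by (simp add: gr_def gr_component_one restrict_UNIV)

lemma gr_neg:
  assumes "F \<in> carrier (gr A \<Gamma>)"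
  shows "\<ominus>\<^bsub>gr A \<Gamma>\<^esub> F = (\<lambda>n. inv\<^bsub>gr_component A \<Gamma> n\<^esub> (F n))"
proof -
  have "\<ominus>\<^bsub>gr A \<Gamma>\<^esub> F = inv\<^bsub>sum_group UNIV (gr_component A \<Gamma>)\<^esub> F"
    by (simp add: a_inv_def m_inv_def gr_def)
  also have "\<dots> = (\<lambda>n. inv\<^bsub>gr_component A \<Gamma> n\<^esub> (F n))"
    using assms by (subst inv_sum_group) (simp_all add: gr_component_group gr_def restrict_UNIV)
  finally show ?thesis .
qed

lemma gr_mult_leading:
  assumes J: "\<And>d. J d \<subseteq> \<Gamma> d" and F: "F \<in> leading_ideal J M" and G: "G \<in> carrier (gr A \<Gamma>)"
  shows "\<exists>c\<in>\<Gamma> n. (G \<otimes>\<^bsub>gr A \<Gamma>\<^esub> F) n = pre n +> c \<and> c \<in> leading_span A \<Gamma> J M n"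
proof -
  interpret Q: comm_group "gr_component A \<Gamma> n" by (rule gr_component_comm_group)
  define h where "h i = rcoset_mult A (pre n) (G i) (F (n - i))" for i
  have h: "\<exists>c\<in>\<Gamma> n. h i = pre n +> c \<and> c \<in> leading_span A \<Gamma> J M n" if "i \<le> n" for i
  proof -
    have "G i \<in> carrier (gr_component A \<Gamma> i)" using G by (simp add: gr_carrier)
    then obtain a where a: "a \<in> \<Gamma> i" "G i = pre i +> a" by (auto simp: gr_component_carrier)
    obtain b where b: "b \<in> \<Gamma> (n - i)" "F (n - i) = pre (n - i) +> b"
        "b \<in> leading_span A \<Gamma> J M (n - i)"
      using F unfolding leading_ideal_iff[OF J] by blast
    have "h i = pre n +> (a \<otimes> b)" "a \<otimes> b \<in> \<Gamma> n" "a \<otimes> b \<in> leading_span A \<Gamma> J M n"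
      using coset_mult[OF a(1) b(1)] mult_in[OF a(1) b(1)] leading_span_mult[OF J a(1) b(3)] that a b
      by (simp_all add: h_def)
    then show ?thesis by blast
  qed
  have "\<exists>c\<in>\<Gamma> n. (\<Otimes>\<^bsub>gr_component A \<Gamma> n\<^esub> i \<in> K. h i) = pre n +> c \<and> c \<in> leading_span A \<Gamma> J M n"
    if "finite K" "K \<subseteq> {..n}" for K
    using that
  proof (induction K rule: finite_induct)
    case empty
    have "pre n = pre n +> \<zero>" "\<zero> \<in> leading_span A \<Gamma> J M n"
      using pre_zero coset_of_pre by (auto intro: leading_span.lower)
    then show ?case using filt_zero by (auto simp: gr_component_one)
  next
    case (insert k K)
    then obtain c where c: "c \<in> \<Gamma> n" "c \<in> leading_span A \<Gamma> J M n"
        "(\<Otimes>\<^bsub>gr_component A \<Gamma> n\<^esub> i \<in> K. h i) = pre n +> c" by auto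
    obtain b where b: "b \<in> \<Gamma> n" "h k = pre n +> b" "b \<in> leading_span A \<Gamma> J M n"
      using h[of k] insert by auto
    have "h i \<in> carrier (gr_component A \<Gamma> n)" if "i \<le> n" for i
      using h[OF that] by (auto simp: gr_component_carrier)
    then have "(\<Otimes>\<^bsub>gr_component A \<Gamma> n\<^esub> i \<in> insert k K. h i) =
        h k \<otimes>\<^bsub>gr_component A \<Gamma> n\<^esub> (\<Otimes>\<^bsub>gr_component A \<Gamma> n\<^esub> i \<in> K. h i)"
      using insert by (intro Q.finprod_insert) auto
    then have "(\<Otimes>\<^bsub>gr_component A \<Gamma> n\<^esub> i \<in> insert k K. h i) = pre n +> (b \<oplus> c)"
      using b c filt_carrier by (simp add: gr_component_mult coset_add)
    then show ?case using b c by (auto intro!: bexI[of _ "b \<oplus> c"] filt_add leading_span.add)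
  qed
  from this[of "{..n}"] show ?thesis by (simp add: gr_mult h_def)
qed

lemma gr_mult_finite_support:
  assumes F: "F \<in> carrier (gr A \<Gamma>)" and G: "G \<in> carrier (gr A \<Gamma>)"
  shows "finite {n. (G \<otimes>\<^bsub>gr A \<Gamma>\<^esub> F) n \<noteq> pre n}"
proof -
  obtain k l where k: "\<And>n. n > k \<Longrightarrow> F n = pre n" and l: "\<And>n. n > l \<Longrightarrow> G n = pre n"
    using F G unfolding gr_carrier finite_nat_set_iff_bounded_le by (auto simp: not_le) (metis not_le)
  have "(G \<otimes>\<^bsub>gr A \<Gamma>\<^esub> F) n = pre n" if n: "n > k + l" for n
  proof -
    interpret Q: comm_group "gr_component A \<Gamma> n" by (rule gr_component_comm_group)
    have "rcoset_mult A (pre n) (G i) (F (n - i)) = \<one>\<^bsub>gr_component A \<Gamma> n\<^esub>" if i: "i \<le> n" for i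
    proof -
      have "G i \<in> carrier (gr_component A \<Gamma> i)" "F (n - i) \<in> carrier (gr_component A \<Gamma> (n - i))"
        using F G by (simp_all add: gr_carrier)
      then obtain a b where ab: "a \<in> \<Gamma> i" "G i = pre i +> a" "b \<in> \<Gamma> (n - i)" "F (n - i) = pre (n - i) +> b"
        by (auto simp: gr_component_carrier)
      have "a \<otimes> b \<in> pre n"
      proof (cases "i > l")
        case True
        then have "a \<in> pre i" using l[of i] ab(2) coset_self[OF filt_carrier[OF ab(1)], of i] by simp
        with pre_mult_right[OF this ab(3)] i show ?thesis by simp
      next
        case False
        then have "b \<in> pre (n - i)"
          using n k[of "n - i"] ab(4) coset_self[OF filt_carrier[OF ab(3)], of "n - i"] by simp
        with pre_mult_left[OF ab(1) this] i show ?thesis by simp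
      qed
      then show ?thesis
        using coset_mult[OF ab(1,3)] ab i coset_of_pre by (simp add: gr_component_one)
    qed
    then show ?thesis
      unfolding gr_mult by (subst Q.finprod_one_eqI) (auto simp: gr_component_one)
  qed
  then have "{n. (G \<otimes>\<^bsub>gr A \<Gamma>\<^esub> F) n \<noteq> pre n} \<subseteq> {..k + l}" by (auto simp: not_less[symmetric])
  then show ?thesis by (rule finite_subset) simp
qed

lemma leading_ideal_left_ideal:
  assumes J: "\<And>d. J d \<subseteq> \<Gamma> d"
  shows "left_ideal (leading_ideal J M) (gr A \<Gamma>)"
proof (intro left_ideal.intro additive_subgroup.intro left_ideal_axioms.intro subgroup.intro)
  note iff = leading_ideal_iff[OF J]
  show "leading_ideal J M \<subseteq> carrier (add_monoid (gr A \<Gamma>))" by (auto simp: leading_ideal_def)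
  have "F \<oplus>\<^bsub>gr A \<Gamma>\<^esub> G \<in> leading_ideal J M" if FG: "F \<in> leading_ideal J M" "G \<in> leading_ideal J M" for F G
    unfolding iff
  proof (intro conjI allI)
    fix n
    obtain a b where "a \<in> \<Gamma> n" "F n = pre n +> a" "a \<in> leading_span A \<Gamma> J M n"
        "b \<in> \<Gamma> n" "G n = pre n +> b" "b \<in> leading_span A \<Gamma> J M n"
      using FG unfolding iff by metis
    then show "\<exists>a\<in>\<Gamma> n. (F \<oplus>\<^bsub>gr A \<Gamma>\<^esub> G) n = pre n +> a \<and> a \<in> leading_span A \<Gamma> J M n"
      using filt_carrier
      by (auto simp: gr_add coset_add intro!: bexI[of _ "a \<oplus> b"] filt_add leading_span.add)
  next
    have "pre n <+> pre n = pre n" for n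
      using coset_add[of \<zero> \<zero> n] coset_of_pre[OF pre_zero] by simp
    then have "{n. (F \<oplus>\<^bsub>gr A \<Gamma>\<^esub> G) n \<noteq> pre n} \<subseteq> {n. F n \<noteq> pre n} \<union> {n. G n \<noteq> pre n}"
      by (auto simp: gr_add)
    then show "finite {n. (F \<oplus>\<^bsub>gr A \<Gamma>\<^esub> G) n \<noteq> pre n}"
      by (rule finite_subset) (use FG in \<open>simp add: iff\<close>)
  qed
  then show "F \<otimes>\<^bsub>add_monoid (gr A \<Gamma>)\<^esub> G \<in> leading_ideal J M"
    if "F \<in> leading_ideal J M" "G \<in> leading_ideal J M" for F G
    using that by simp
  have "\<exists>a\<in>\<Gamma> n. pre n = pre n +> a \<and> a \<in> leading_span A \<Gamma> J M n" for n
    using filt_zero pre_zero coset_of_pre[OF pre_zero] by (auto intro!: bexI[of _ \<zero>] leading_span.lower)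
  then show "\<one>\<^bsub>add_monoid (gr A \<Gamma>)\<^esub> \<in> leading_ideal J M"
    by (simp add: gr_zero iff)
  show "inv\<^bsub>add_monoid (gr A \<Gamma>)\<^esub> F \<in> leading_ideal J M" if F: "F \<in> leading_ideal J M" for F
  proof -
    have "F \<in> carrier (gr A \<Gamma>)" using F by (simp add: leading_ideal_def)
    then have neg: "inv\<^bsub>add_monoid (gr A \<Gamma>)\<^esub> F = (\<lambda>n. inv\<^bsub>gr_component A \<Gamma> n\<^esub> (F n))"
      using gr_neg unfolding a_inv_def by blast
    have "inv\<^bsub>gr_component A \<Gamma> n\<^esub> (pre n) = pre n" for n
      using monoid.inv_one[OF group.is_monoid[OF gr_component_group], of n] by (simp add: gr_component_one)
    then have "{n. inv\<^bsub>gr_component A \<Gamma> n\<^esub> (F n) \<noteq> pre n} \<subseteq> {n. F n \<noteq> pre n}" by auto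
    moreover have "\<exists>a\<in>\<Gamma> n. inv\<^bsub>gr_component A \<Gamma> n\<^esub> (F n) = pre n +> a \<and> a \<in> leading_span A \<Gamma> J M n" for n
    proof -
      obtain a where a: "a \<in> \<Gamma> n" "F n = pre n +> a" "a \<in> leading_span A \<Gamma> J M n"
        using F unfolding iff by blast
      then show ?thesis
        by (auto simp: gr_component_inv intro!: bexI[of _ "\<ominus> a"] filt_neg leading_span_neg[OF J])
    qed
    ultimately show ?thesis
      using F unfolding neg iff by (auto intro: finite_subset)
  qed
  show "G \<otimes>\<^bsub>gr A \<Gamma>\<^esub> F \<in> leading_ideal J M" if F: "F \<in> leading_ideal J M" and G: "G \<in> carrier (gr A \<Gamma>)" for F G
  proof -
    have "F \<in> carrier (gr A \<Gamma>)" using F by (simp add: leading_ideal_def)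
    then show ?thesis
      unfolding iff using gr_mult_leading[OF J F G] gr_mult_finite_support[OF _ G] by blast
  qed
qed

text \<open>The form in which left noetherianity of the associated graded ring is used.  The left ideals
  generated by the leading terms of degree at most \<open>M\<close> form an ascending chain in \<open>M\<close>.  Where it
  stops, every \<open>x \<in> J n\<close> is covered: its class lies in the ideal with index \<open>max M n\<close>, because
  \<open>x = 1 x\<close> with \<open>1 \<in> \<Gamma>\<^bsub>0\<^esub>\<close>.\<close>

lemma leading_span_stops:
  assumes noeth: "left_noetherian (gr A \<Gamma>)" and J: "\<And>d. J d \<subseteq> \<Gamma> d"
  shows "\<exists>M. \<forall>n. J n \<subseteq> leading_span A \<Gamma> J M n"
proof -
  have mono: "x \<in> leading_span A \<Gamma> J M' n" if "x \<in> leading_span A \<Gamma> J M n" "M \<le> M'" for x M M' n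
    using that(1)
  proof induction
    case (prod d a b)
    then show ?case using that(2) by (intro leading_span.prod) auto
  qed (auto intro: leading_span.lower leading_span.add)
  have "\<forall>M. leading_ideal J M \<subseteq> leading_ideal J (Suc M)"
    using mono[OF _ le_SucI[OF order_refl]] unfolding leading_ideal_def by blast
  then obtain M where M: "\<And>M'. M' \<ge> M \<Longrightarrow> leading_ideal J M' = leading_ideal J M"
    using noeth[unfolded left_noetherian_def, THEN spec, of "leading_ideal J"]
      leading_ideal_left_ideal[OF J] by blast
  have "x \<in> leading_span A \<Gamma> J M n" if x: "x \<in> J n" for n x
  proof -
    have xn: "x \<in> \<Gamma> n" using x J by blast
    have "\<one> \<otimes> x \<in> leading_span A \<Gamma> J (max M n) n"
      by (rule leading_span.prod[of n]) (use x one_in in auto)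
    then have x': "x \<in> leading_span A \<Gamma> J (max M n) n" using filt_carrier[OF xn] by simp
    define F where "F = (\<lambda>m. if m = n then pre n +> x else pre m)"
    have "\<exists>a\<in>\<Gamma> m. F m = pre m +> a \<and> a \<in> leading_span A \<Gamma> J (max M n) m" for m
    proof (cases "m = n")
      case True
      then show ?thesis using xn x' by (auto simp: F_def)
    next
      case False
      then show ?thesis using filt_zero pre_zero coset_of_pre[OF pre_zero]
        by (auto simp: F_def intro!: bexI[of _ \<zero>] leading_span.lower)
    qed
    moreover have "finite {m. F m \<noteq> pre m}" by (rule finite_subset[of _ "{n}"]) (auto simp: F_def)
    ultimately have "F \<in> leading_ideal J (max M n)" unfolding leading_ideal_iff[OF J] by blast
    then have "F \<in> leading_ideal J M" using M[of "max M n"] by simp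
    then have "F n \<subseteq> leading_span A \<Gamma> J M n" by (simp add: leading_ideal_def)
    then have "pre n +> x \<subseteq> leading_span A \<Gamma> J M n" by (simp add: F_def)
    then show ?thesis using leading_span_coset[OF J xn] by blast
  qed
  then show ?thesis by blast
qed

end

section \<open>The algebra as a ring of matrices\<close>

definition mat22 :: "'a \<Rightarrow> 'a \<Rightarrow> 'a \<Rightarrow> 'a \<Rightarrow> 'a mat" where
  "mat22 a b c d = mat_of_rows_list 2 [[a, b], [c, d]]"

lemma mat22_dim [simp]: "dim_row (mat22 a b c d) = 2" "dim_col (mat22 a b c d) = 2"
  by (simp_all add: mat22_def mat_of_rows_list_def)

lemma mat22_carrier [simp]: "mat22 a b c d \<in> carrier_mat 2 2"
  by (rule carrier_matI) simp_all

lemma mat22_entries [simp]: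
  "mat22 a b c d $$ (0, 0) = a" "mat22 a b c d $$ (0, Suc 0) = b"
  "mat22 a b c d $$ (Suc 0, 0) = c" "mat22 a b c d $$ (Suc 0, Suc 0) = d"
  by (simp_all add: mat22_def mat_of_rows_list_def)

lemma eq_mat22I:
  assumes "s \<in> carrier_mat 2 2" "s $$ (0,0) = a" "s $$ (0,1) = b" "s $$ (1,0) = c" "s $$ (1,1) = d"
  shows "s = mat22 a b c d"
proof (rule eq_matI)
  fix i j assume "i < dim_row (mat22 a b c d)" "j < dim_col (mat22 a b c d)"
  then have "i = 0 \<or> i = 1" "j = 0 \<or> j = 1" by auto
  with assms show "s $$ (i, j) = mat22 a b c d $$ (i, j)" by auto
qed (use assms in auto)

lemma mat22_cases:
  assumes "s \<in> carrier_mat 2 2" obtains a b c d where "s = mat22 a b c d"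
  using eq_mat22I[OF assms refl refl refl refl] by blast

lemma mat22_eq_iff [simp]: "mat22 a b c d = mat22 a' b' c' d' \<longleftrightarrow> a = a' \<and> b = b' \<and> c = c' \<and> d = d'"
  by (metis mat22_entries)

lemma mat22_add [simp]: "mat22 a b c d + mat22 a' b' c' d' = mat22 (a + a') (b + b') (c + c') (d + d')"
  by (rule eq_mat22I) auto

lemma mat22_minus [simp]:
  "mat22 a b c d - mat22 a' b' c' d' = mat22 (a - a') (b - b') (c - c') (d - d')"
  by (rule eq_mat22I) auto

lemma mat22_mult [simp]:
  "mat22 a b c d * mat22 a' b' c' d' =
    mat22 (a * a' + b * c') (a * b' + b * d') (c * a' + d * c') (c * b' + d * d')"
  by (rule eq_mat22I) (auto simp: times_mat_def scalar_prod_def numeral_2_eq_2)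

lemma mat22_smult [simp]: "r \<cdot>\<^sub>m mat22 a b c d = mat22 (r * a) (r * b) (r * c) (r * d)"
  by (rule eq_mat22I) auto

lemma mat22_one: "1\<^sub>m 2 = mat22 1 0 0 1"
  by (rule eq_mat22I) auto

lemma mat22_zero: "0\<^sub>m 2 2 = mat22 0 0 0 0"
  by (rule eq_mat22I) auto

abbreviation sq :: "'k::field poly \<Rightarrow> 'k poly" where "sq f \<equiv> f \<circ>\<^sub>p [:0, 1:]^2"

text \<open>Membership only concerns the reduction modulo \<open>y\<close>, that is, the coefficients of \<open>y^0\<close>.\<close>

lemma S_set_mat22: "mat22 a b c d \<in> S_set \<longleftrightarrow> coeff c 0 = 0 \<and> coeff d 0 = sq (coeff a 0)"
proof
  assume "mat22 a b c d \<in> S_set"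
  then obtain f g M where M: "M \<in> carrier_mat 2 2"
    and eq: "mat22 a b c d = mat22 [:f:] [:g:] 0 [:sq f:] + [:0, 1:] \<cdot>\<^sub>m M"
    unfolding S_set_def mat22_def[symmetric] by auto
  from M obtain p q r t where "M = mat22 p q r t" by (rule mat22_cases)
  with eq show "coeff c 0 = 0 \<and> coeff d 0 = sq (coeff a 0)" by simp
next
  assume *: "coeff c 0 = 0 \<and> coeff d 0 = sq (coeff a 0)"
  obtain p q r t where "a = pCons (coeff a 0) p" "b = pCons (coeff b 0) q" "c = pCons (coeff c 0) r"
      "d = pCons (coeff d 0) t"
    by (metis coeff_pCons_0 pCons_cases)
  with * have "mat22 a b c d =
      mat22 [:coeff a 0:] [:coeff b 0:] 0 [:sq (coeff a 0):] + [:0, 1:] \<cdot>\<^sub>m mat22 p q r t"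
    by simp
  then show "mat22 a b c d \<in> S_set"
    unfolding S_set_def mat22_def[symmetric]
    by (intro CollectI exI[of _ "coeff a 0"] exI[of _ "coeff b 0"] exI[of _ "mat22 p q r t"]) auto
qed

lemma S_set_cases:
  assumes "s \<in> S_set"
  obtains a b c d where "s = mat22 a b c d" "coeff c 0 = 0" "coeff d 0 = sq (coeff a 0)"
proof -
  have "s \<in> carrier_mat 2 2" using assms unfolding S_set_def mat22_def[symmetric] by auto
  then obtain a b c d where "s = mat22 a b c d" by (rule mat22_cases)
  with assms S_set_mat22[of a b c d] that show ?thesis by simp
qed

lemma S_alg_simps [simp]:
  "carrier S_alg = S_set" "s \<otimes>\<^bsub>S_alg\<^esub> t = s * t" "s \<oplus>\<^bsub>S_alg\<^esub> t = s + t"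
  "\<one>\<^bsub>S_alg\<^esub> = mat22 1 0 0 1" "\<zero>\<^bsub>S_alg\<^esub> = mat22 0 0 0 0"
  by (simp_all add: S_alg_def ring_mat_simps mat22_one mat22_zero)

lemma scalars_mat22: "scalars = range (\<lambda>c :: 'k::field. mat22 [:[:c:]:] 0 0 [:[:c:]:])"
  by (simp add: scalars_def mat22_one)

interpretation S: ring "S_alg :: 'k::field poly poly mat ring"
proof (rule ringI)
  show "abelian_group (S_alg :: 'k poly poly mat ring)"
  proof (rule abelian_groupI)
    fix x :: "'k poly poly mat" assume "x \<in> carrier S_alg"
    then obtain a b c d where x: "x = mat22 a b c d" "coeff c 0 = 0" "coeff d 0 = sq (coeff a 0)"
      by (auto elim: S_set_cases)
    then show "\<exists>y\<in>carrier S_alg. y \<oplus>\<^bsub>S_alg\<^esub> x = \<zero>\<^bsub>S_alg\<^esub>"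
      by (auto simp: S_set_mat22 pcompose_uminus intro!: bexI[of _ "mat22 (-a) (-b) (-c) (-d)"])
  qed (auto elim!: S_set_cases simp: S_set_mat22 pcompose_add algebra_simps)
  show "Group.monoid (S_alg :: 'k poly poly mat ring)"
    by (rule monoidI)
      (auto elim!: S_set_cases simp: S_set_mat22 pcompose_add pcompose_mult coeff_mult_0 pcompose_1 algebra_simps)
qed (auto elim!: S_set_cases simp: algebra_simps)

lemma S_neg: "mat22 a b c d \<in> S_set \<Longrightarrow> \<ominus>\<^bsub>S_alg\<^esub> mat22 a b c d = mat22 (-a) (-b) (-c) (-d)"
  by (rule S.minus_equality) (auto simp: S_set_mat22 pcompose_uminus)

lemma S_minus:
  assumes "s \<in> S_set" "t \<in> S_set" shows "s \<ominus>\<^bsub>S_alg\<^esub> t = s - t"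
proof -
  obtain a b c d a' b' c' d' where "s = mat22 a b c d" "t = mat22 a' b' c' d'"
    using assms by (metis S_set_cases)
  with assms show ?thesis by (simp add: a_minus_def S_neg)
qed

lemma scalars_subset: "scalars \<subseteq> S_set"
  by (auto simp: scalars_mat22 S_set_mat22 pcompose_const)

lemma scalars_subfield: "subfield (scalars :: 'k::field poly poly mat set) S_alg"
proof (rule S.subfieldI)
  let ?K = "scalars :: 'k poly poly mat set" and ?S = "S_alg :: 'k poly poly mat ring"
  let ?c = "\<lambda>c::'k. mat22 [:[:c:]:] 0 0 [:[:c:]:]"
  have sub: "subring ?K ?S"
  proof (rule S.subringI)
    show "\<one>\<^bsub>?S\<^esub> \<in> ?K" by (auto simp: scalars_mat22 one_pCons)
    show "\<ominus>\<^bsub>?S\<^esub> h \<in> ?K" if "h \<in> ?K" for h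
    proof -
      obtain c where c: "h = ?c c" using \<open>h \<in> ?K\<close> by (auto simp: scalars_mat22)
      then have "\<ominus>\<^bsub>?S\<^esub> h = ?c (- c)" using \<open>h \<in> ?K\<close> scalars_subset S_neg[of "[:[:c:]:]" 0 0 "[:[:c:]:]"] by auto
      then show ?thesis by (auto simp: scalars_mat22)
    qed
  qed (use scalars_subset in \<open>auto simp: scalars_mat22\<close>)
  show "subcring ?K ?S"
    by (rule S.subcringI[OF sub]) (auto simp: scalars_mat22 mult.commute)
  show "Units (?S\<lparr>carrier := ?K\<rparr>) = ?K - {\<zero>\<^bsub>?S\<^esub>}"
  proof
    show "Units (?S\<lparr>carrier := ?K\<rparr>) \<subseteq> ?K - {\<zero>\<^bsub>?S\<^esub>}"
      by (auto simp: Units_def scalars_mat22)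
    show "?K - {\<zero>\<^bsub>?S\<^esub>} \<subseteq> Units (?S\<lparr>carrier := ?K\<rparr>)"
    proof
      fix s assume "s \<in> ?K - {\<zero>\<^bsub>?S\<^esub>}"
      then obtain c where c: "s = ?c c" "c \<noteq> 0" by (auto simp: scalars_mat22)
      then have "?c (inverse c) \<in> ?K" "?c (inverse c) * s = mat22 1 0 0 1" "s * ?c (inverse c) = mat22 1 0 0 1"
        by (auto simp: scalars_mat22 one_pCons)
      moreover have "s \<in> ?K" using c by (simp add: scalars_mat22)
      ultimately show "s \<in> Units (?S\<lparr>carrier := ?K\<rparr>)" unfolding Units_def by auto
    qed
  qed
qed

lemma S_algebra: "algebra_over (scalars :: 'k::field poly poly mat set) S_alg"
proof (intro algebra_over.intro embedded_algebra.intro algebra_over_axioms.intro)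
  show "subfield (scalars :: 'k poly poly mat set) S_alg" by (rule scalars_subfield)
  show "ring (S_alg :: 'k poly poly mat ring)" by (rule S.ring_axioms)
  show "c \<otimes>\<^bsub>S_alg\<^esub> a = a \<otimes>\<^bsub>S_alg\<^esub> c" if "c \<in> scalars" "a \<in> carrier S_alg" for a c :: "'k poly poly mat"
    using that by (auto simp: scalars_mat22 mult.commute elim!: S_set_cases)
qed


section \<open>Noetherian, affine, prime and PI\<close>

lemma sq_x: "sq [:0, 1:] = monom 1 2"
  by (simp add: monom_altdef pcompose_pCons)

lemma degree_sq: "degree (sq f) = 2 * degree f"
  by (simp add: degree_pcompose degree_power_eq mult.commute)

text \<open>For \<open>x^2\<close> the two positions need different matrices, \<open>diag(x^2, x^4)\<close> and \<open>diag(x, x^2)\<close>.\<close>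

lemma diag_multiplier:
  assumes "m \<in> xsq_y_multipliers"
  shows "\<exists>p q. mat22 p 0 0 q \<in> S_set \<and> (if i = (0::nat) then p else q) = m"
proof -
  consider "m = [:0, 1:]" | "m = [:monom 1 2:]" | c where "m = [:[:c:]:]"
    using assms by (auto simp: xsq_y_multipliers_def)
  then show ?thesis
  proof cases
    case 1
    have "mat22 [:0, 1:] 0 0 [:0, 1:] \<in> S_set" by (simp add: S_set_mat22)
    with 1 show ?thesis by force
  next
    case 2
    have "mat22 [:monom 1 2:] 0 0 [:sq (monom 1 2):] \<in> S_set"
        "mat22 [:[:0, 1:]:] 0 0 [:monom 1 2:] \<in> S_set"
      by (simp_all add: S_set_mat22 sq_x)
    with 2 show ?thesis by (cases "i = 0") (simp, blast)+
  next
    case 3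
    have "mat22 [:[:c:]:] 0 0 [:[:c:]:] \<in> S_set" by (simp add: S_set_mat22)
    with 3 show ?thesis by force
  qed
qed

lemma additive_subgroup_matrix:
  assumes "additive_subgroup I S_alg"
  shows "I \<subseteq> S_set" "0\<^sub>m 2 2 \<in> I" "s \<in> I \<Longrightarrow> t \<in> I \<Longrightarrow> s - t \<in> I"
proof -
  interpret I: additive_subgroup I S_alg by (rule assms)
  show sub: "I \<subseteq> S_set" using I.a_subset by simp
  show "0\<^sub>m 2 2 \<in> I" using I.zero_closed by (simp add: mat22_zero)
  assume "s \<in> I" "t \<in> I"
  then have st: "s \<in> S_set" "t \<in> S_set" using sub by blast+
  have "s \<ominus>\<^bsub>S_alg\<^esub> t \<in> I"
    unfolding a_minus_def using \<open>s \<in> I\<close> \<open>t \<in> I\<close> by (rule I.a_closed[OF _ I.a_inv_closed])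
  then show "s - t \<in> I" unfolding S_minus[OF st] .
qed

lemma S_set_carrier: "S_set \<subseteq> carrier_mat 2 2"
  by (auto elim!: S_set_cases)

text \<open>Left multiplication by a diagonal matrix scales rows, right multiplication scales columns; both
  keep zero entries, so the two sides follow from the same statement about chains.\<close>

lemma S_left_noetherian: "left_noetherian (S_alg :: 'k::field poly poly mat ring)"
  unfolding left_noetherian_def
proof (intro allI impI, elim conjE)
  fix I :: "nat \<Rightarrow> 'k poly poly mat set"
  assume I: "\<forall>n. left_ideal (I n) S_alg" and asc: "\<forall>n. I n \<subseteq> I (Suc n)"
  note sub = additive_subgroup_matrix[OF left_ideal.axioms(1)[OF I[rule_format]]]
  show "\<exists>N. \<forall>n\<ge>N. I n = I N"
  proof (rule matrix_chain_stops)
    fix n s and m :: "'k poly poly" and i j :: nat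
    assume s: "s \<in> I n" and m: "m \<in> xsq_y_multipliers" and ij: "i < 2" "j < 2"
    obtain a b c d where s': "s = mat22 a b c d" using s sub(1) by (metis S_set_cases subsetD)
    obtain p q where pq: "mat22 p 0 0 q \<in> S_set" "(if i = 0 then p else q) = m"
      using diag_multiplier[OF m] by blast
    have "mat22 p 0 0 q * s \<in> I n"
      using left_ideal.left_closed[OF I[rule_format] s, of "mat22 p 0 0 q"] pq(1) by simp
    then show "\<exists>t\<in>I n. t $$ (i, j) = m * s $$ (i, j) \<and>
         (\<forall>i'<2. \<forall>j'<2. s $$ (i', j') = 0 \<longrightarrow> t $$ (i', j') = 0)"
      by (rule rev_bexI) (use pq(2) ij in \<open>auto simp: s' less_2_cases_iff\<close>)
  qed (use sub S_set_carrier asc in blast)+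
qed

lemma S_right_noetherian: "right_noetherian (S_alg :: 'k::field poly poly mat ring)"
  unfolding right_noetherian_def
proof (intro allI impI, elim conjE)
  fix I :: "nat \<Rightarrow> 'k poly poly mat set"
  assume I: "\<forall>n. right_ideal (I n) S_alg" and asc: "\<forall>n. I n \<subseteq> I (Suc n)"
  note sub = additive_subgroup_matrix[OF right_ideal.axioms(1)[OF I[rule_format]]]
  show "\<exists>N. \<forall>n\<ge>N. I n = I N"
  proof (rule matrix_chain_stops)
    fix n s and m :: "'k poly poly" and i j :: nat
    assume s: "s \<in> I n" and m: "m \<in> xsq_y_multipliers" and ij: "i < 2" "j < 2"
    obtain a b c d where s': "s = mat22 a b c d" using s sub(1) by (metis S_set_cases subsetD)
    obtain p q where pq: "mat22 p 0 0 q \<in> S_set" "(if j = 0 then p else q) = m"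
      using diag_multiplier[OF m] by blast
    have "s * mat22 p 0 0 q \<in> I n"
      using right_ideal.right_closed[OF I[rule_format] s, of "mat22 p 0 0 q"] pq(1) by simp
    then show "\<exists>t\<in>I n. t $$ (i, j) = m * s $$ (i, j) \<and>
         (\<forall>i'<2. \<forall>j'<2. s $$ (i', j') = 0 \<longrightarrow> t $$ (i', j') = 0)"
      by (rule rev_bexI) (use pq(2) ij in \<open>auto simp: s' less_2_cases_iff\<close>)
  qed (use sub S_set_carrier asc in blast)+
qed

text \<open>The matrices \<open>diag(x, x^2)\<close>, \<open>e\<^bsub>12\<^esub>\<close> and \<open>y e\<^bsub>21\<^esub>\<close> generate \<open>S\<close>.  The first two give all
  \<open>diag(f, f(x^2))\<close> and \<open>f e\<^bsub>12\<^esub>\<close>; multiplying \<open>y e\<^bsub>21\<^esub>\<close> by these from the left or right gives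
  \<open>y f e\<^bsub>ij\<^esub>\<close> for \<open>(i, j) \<noteq> (1, 2)\<close>, and \<open>y 1 = e\<^bsub>12\<^esub> (y e\<^bsub>21\<^esub>) + (y e\<^bsub>21\<^esub>) e\<^bsub>12\<^esub>\<close> then supplies
  \<open>y f e\<^bsub>12\<^esub>\<close> and the higher powers of \<open>y\<close>.\<close>

lemma S_affine: "affine_algebra (scalars :: 'k::field poly poly mat set) S_alg"
proof -
  let ?\<sigma> = "mat22 [:[:0, 1:]:] 0 0 [:[:0, 1:]^2:] :: 'k poly poly mat"
  let ?e = "mat22 0 1 0 0 :: 'k poly poly mat"
  let ?u = "mat22 0 0 [:0, 1:] 0 :: 'k poly poly mat"
  let ?X = "{?\<sigma>, ?e, ?u}"
  define G where "G = generate_ring S_alg (scalars \<union> ?X)"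
  have X: "?X \<subseteq> S_set" by (simp add: S_set_mat22 sq_x monom_altdef)
  have add: "s + t \<in> G" and mult: "s * t \<in> G" if "s \<in> G" "t \<in> G" for s t
    using generate_ring.eng_add[of s S_alg _ t] generate_ring.eng_mult[of s S_alg _ t] that
    by (simp_all add: G_def)
  have gens: "?\<sigma> \<in> G" "?e \<in> G" "?u \<in> G" "mat22 [:[:c:]:] 0 0 [:[:c:]:] \<in> G" for c
    by (auto simp: G_def scalars_mat22 intro: generate_ring.incl)
  have diag: "mat22 [:f:] 0 0 [:sq f:] \<in> G" for f
  proof (induction f)
    case 0
    show ?case using gens(4)[of 0] by simp
  next
    case (pCons a f)
    have "mat22 [:pCons a f:] 0 0 [:sq (pCons a f):] =
        mat22 [:[:a:]:] 0 0 [:[:a:]:] + ?\<sigma> * mat22 [:f:] 0 0 [:sq f:]"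
      by (simp add: pcompose_pCons)
    then show ?case using add[OF gens(4) mult[OF gens(1) pCons(2)]] by simp
  qed
  have E01: "mat22 0 [:f:] 0 0 \<in> G" for f using mult[OF diag[of f] gens(2)] by simp
  have E00: "mat22 [:0, f:] 0 0 0 \<in> G" for f using mult[OF E01[of f] gens(3)] by simp
  have E10: "mat22 0 0 [:0, f:] 0 \<in> G" for f using mult[OF gens(3) diag[of f]] by simp
  have E11: "mat22 0 0 0 [:0, f:] \<in> G" for f using mult[OF gens(3) E01[of f]] by simp
  have y: "mat22 [:0, 1:] 0 0 [:0, 1:] \<in> G" using add[OF E00[of 1] E11[of 1]] by simp
  have E01y: "mat22 0 [:0, f:] 0 0 \<in> G" for f using mult[OF y E01[of f]] by simp
  have zero: "mat22 0 0 0 0 \<in> G" using E01[of 0] by simp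
  have yp: "mat22 (pCons 0 p) 0 0 0 \<in> G \<and> mat22 0 (pCons 0 p) 0 0 \<in> G \<and>
      mat22 0 0 (pCons 0 p) 0 \<in> G \<and> mat22 0 0 0 (pCons 0 p) \<in> G" for p
  proof (induction p)
    case 0
    show ?case using zero by simp
  next
    case (pCons f p)
    then show ?case
      using add[OF E00[of f] mult[OF y, of "mat22 (pCons 0 p) 0 0 0"]]
        add[OF E01y[of f] mult[OF y, of "mat22 0 (pCons 0 p) 0 0"]]
        add[OF E10[of f] mult[OF y, of "mat22 0 0 (pCons 0 p) 0"]]
        add[OF E11[of f] mult[OF y, of "mat22 0 0 0 (pCons 0 p)"]] by simp
  qed
  have "S_set \<subseteq> G"
  proof
    fix s :: "'k poly poly mat" assume "s \<in> S_set"
    then obtain a b c d where s: "s = mat22 a b c d" "coeff c 0 = 0" "coeff d 0 = sq (coeff a 0)"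
      by (rule S_set_cases)
    obtain f p g q h r k t where abcd: "a = pCons f p" "b = pCons g q" "c = pCons h r" "d = pCons k t"
      by (metis pCons_cases)
    have "s = mat22 [:f:] 0 0 [:sq f:] + mat22 0 [:g:] 0 0 + mat22 (pCons 0 p) 0 0 0 +
        mat22 0 (pCons 0 q) 0 0 + mat22 0 0 (pCons 0 r) 0 + mat22 0 0 0 (pCons 0 t)"
      using s by (simp add: abcd)
    also have "\<dots> \<in> G" using yp by (intro add diag E01) auto
    finally show "s \<in> G" .
  qed
  moreover have "G \<subseteq> S_set"
    using S.generate_ring_incl[of "scalars \<union> ?X"] X scalars_subset by (simp add: G_def)
  ultimately have "G = S_set" by blast
  then show ?thesis unfolding affine_algebra_def
    using X by (intro exI[of _ ?X]) (simp add: G_def)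
qed

text \<open>The words of \<open>[[X\<^sub>0, X\<^sub>1]^2, X\<^sub>2]\<close> with coefficient \<open>1\<close> and \<open>-1\<close>.\<close>

definition hall_pos :: "nat list set" where
  "hall_pos = {[0,1,0,1,2], [1,0,1,0,2], [2,0,1,1,0], [2,1,0,0,1]}"

definition hall_neg :: "nat list set" where
  "hall_neg = {[0,1,1,0,2], [1,0,0,1,2], [2,0,1,0,1], [2,1,0,1,0]}"

definition hall_poly :: "nat list \<Rightarrow> 'k::field poly poly mat" where
  "hall_poly w = (if w \<in> hall_pos then mat22 1 0 0 1
     else if w \<in> hall_neg then mat22 (-1) 0 0 (-1) else mat22 0 0 0 0)"

text \<open>Hall's identity for \<open>2 \<times> 2\<close> matrices over a commutative ring: a commutator has trace zero, so its
  square is a scalar matrix.\<close>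

lemma S_PI: "PI_algebra (scalars :: 'k::field poly poly mat set) S_alg"
  unfolding PI_algebra_def
proof (intro bexI conjI allI impI)
  let ?p = "hall_poly :: nat list \<Rightarrow> 'k poly poly mat"
  have supp: "{w. ?p w \<noteq> \<zero>\<^bsub>S_alg\<^esub>} = hall_pos \<union> hall_neg"
    by (auto simp: hall_poly_def)
  have sc: "mat22 1 0 0 1 \<in> (scalars :: 'k poly poly mat set)"
      "mat22 (-1) 0 0 (-1) \<in> (scalars :: 'k poly poly mat set)"
      "mat22 0 0 0 0 \<in> (scalars :: 'k poly poly mat set)"
    unfolding scalars_mat22
    by (rule range_eqI[of _ _ 1], simp add: one_pCons, rule range_eqI[of _ _ "-1"],
        simp add: one_pCons, rule range_eqI[of _ _ 0], simp)
  then have range: "?p w \<in> scalars" for w by (simp add: hall_poly_def)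
  have "finite {w. ?p w \<noteq> \<zero>\<^bsub>S_alg\<^esub>}"
    unfolding supp by (simp add: hall_pos_def hall_neg_def)
  with range show "?p \<in> free_algebra_carrier scalars S_alg"
    unfolding free_algebra_carrier_def by auto
  have "?p [0,1,0,1,2] \<noteq> \<zero>\<^bsub>S_alg\<^esub>" by (simp add: hall_poly_def hall_pos_def)
  then show "\<exists>w. ?p w \<noteq> \<zero>\<^bsub>S_alg\<^esub>" ..
  fix a :: "nat \<Rightarrow> 'k poly poly mat" assume a: "range a \<subseteq> carrier S_alg"
  define h where "h w = ?p w \<otimes>\<^bsub>S_alg\<^esub> foldr (\<lambda>i b. a i \<otimes>\<^bsub>S_alg\<^esub> b) w \<one>\<^bsub>S_alg\<^esub>" for w
  have "foldr (\<lambda>i b. a i \<otimes>\<^bsub>S_alg\<^esub> b) w \<one>\<^bsub>S_alg\<^esub> \<in> carrier S_alg" for w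
    using a by (induction w) (auto simp del: S_alg_simps intro!: S.m_closed)
  moreover have "?p w \<in> carrier S_alg" for w using range scalars_subset by auto
  ultimately have h: "h w \<in> carrier S_alg" for w unfolding h_def by (intro S.m_closed)
  have ins: "finsum S_alg h (insert w F) = h w + finsum S_alg h F" if "finite F" "w \<notin> F" for w F
    using S.finsum_insert[OF that, of h] h by simp
  obtain p q r t where 0: "a 0 = mat22 p q r t" using a by (metis S_alg_simps(1) S_set_cases range_subsetD)
  obtain p' q' r' t' where 1: "a (Suc 0) = mat22 p' q' r' t'" using a by (metis S_alg_simps(1) S_set_cases range_subsetD)
  obtain p'' q'' r'' t'' where 2: "a 2 = mat22 p'' q'' r'' t''" using a by (metis S_alg_simps(1) S_set_cases range_subsetD)
  have "free_algebra_eval S_alg ?p a = finsum S_alg h (hall_pos \<union> hall_neg)"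
    unfolding free_algebra_eval_def supp h_def ..
  also have "\<dots> = h [0,1,1,0,2] + (h [1,0,0,1,2] + (h [2,0,1,0,1] + (h [2,1,0,1,0] +
      (h [0,1,0,1,2] + (h [1,0,1,0,2] + (h [2,0,1,1,0] + (h [2,1,0,0,1] + mat22 0 0 0 0)))))))"
    by (simp add: hall_pos_def hall_neg_def ins)
  also have "\<dots> = mat22 0 0 0 0"
    by (simp add: h_def hall_poly_def hall_pos_def hall_neg_def 0 1 2) (simp add: algebra_simps)
  finally show "free_algebra_eval S_alg ?p a = \<zero>\<^bsub>S_alg\<^esub>" by simp
qed

text \<open>Since \<open>y M\<^sub>2(k[x,y])\<close> lies in \<open>S\<close>, for nonzero \<open>s\<close> and \<open>t\<close> some product
  \<open>s (y e\<^bsub>ij\<^esub>) t\<close> is nonzero: its entries are \<open>y\<close> times an entry of \<open>s\<close> times an entry of \<open>t\<close>.\<close>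

lemma S_prime: "prime_ring (S_alg :: 'k::field poly poly mat ring)"
  unfolding prime_ring_def
proof (intro conjI allI impI)
  show "\<one>\<^bsub>S_alg\<^esub> \<noteq> (\<zero>\<^bsub>S_alg\<^esub> :: 'k poly poly mat)" by simp
  fix I J :: "'k poly poly mat set"
  assume "ideal I S_alg \<and> ideal J S_alg \<and> ideal_prod S_alg I J = {\<zero>\<^bsub>S_alg\<^esub>}"
  then have I: "ideal I S_alg" and J: "ideal J S_alg" and IJ: "ideal_prod S_alg I J = {\<zero>\<^bsub>S_alg\<^esub>}" by auto
  show "I = {\<zero>\<^bsub>S_alg\<^esub>} \<or> J = {\<zero>\<^bsub>S_alg\<^esub>}"
  proof (rule ccontr)
    assume "\<not> (I = {\<zero>\<^bsub>S_alg\<^esub>} \<or> J = {\<zero>\<^bsub>S_alg\<^esub>})"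
    moreover have "\<zero>\<^bsub>S_alg\<^esub> \<in> I" "\<zero>\<^bsub>S_alg\<^esub> \<in> J"
      using I J by (simp_all add: additive_subgroup.zero_closed ideal.axioms(1) del: S_alg_simps)
    ultimately obtain s t where s: "s \<in> I" "s \<noteq> \<zero>\<^bsub>S_alg\<^esub>" and t: "t \<in> J" "t \<noteq> \<zero>\<^bsub>S_alg\<^esub>" by blast
    have "s \<in> S_set" "t \<in> S_set"
      using s t ideal.Icarr[OF I] ideal.Icarr[OF J] by auto
    then obtain a b c d a' b' c' d' where st: "s = mat22 a b c d" "t = mat22 a' b' c' d'"
      by (metis S_set_cases)
    have "s * mat22 p q r v * t = mat22 0 0 0 0" if "mat22 p q r v \<in> S_set" for p q r v
    proof -
      have "s * mat22 p q r v \<in> I" using ideal.I_r_closed[OF I s(1)] that by simp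
      from ideal_prod.prod[OF this t(1), of S_alg] show ?thesis using IJ by simp
    qed
    from this[of "[:0,1:]" 0 0 0] this[of 0 "[:0,1:]" 0 0] this[of 0 0 "[:0,1:]" 0] this[of 0 0 0 "[:0,1:]"]
    show False using s t unfolding st by (auto simp: S_set_mat22 st simp del: mult_pCons_left mult_pCons_right)
  qed
qed

section \<open>Filtrations of the algebra\<close>

text \<open>Modulo \<open>y\<close>, an element of \<open>S\<close> is determined by \<open>f = top_part\<close> and \<open>g = corner_part\<close>.\<close>

definition top_part :: "'k::field poly poly mat \<Rightarrow> 'k poly" where
  "top_part s = coeff (s $$ (0, 0)) 0"

definition corner_part :: "'k::field poly poly mat \<Rightarrow> 'k poly" where
  "corner_part s = coeff (s $$ (0, 1)) 0"

lemma parts_mat22 [simp]: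
  "top_part (mat22 a b c d) = coeff a 0" "corner_part (mat22 a b c d) = coeff b 0"
  by (simp_all add: top_part_def corner_part_def)

lemma parts_add:
  assumes "s \<in> S_set" "t \<in> S_set"
  shows "top_part (s + t) = top_part s + top_part t"
    and "corner_part (s + t) = corner_part s + corner_part t"
  using assms by (auto elim!: S_set_cases)

text \<open>The two terms of the corner show the asymmetry on which everything rests: \<open>S\<close> acts on \<open>g\<close> from the
  left through \<open>f(x)\<close> and from the right through \<open>f(x^2)\<close>.\<close>

lemma parts_mult:
  assumes "s \<in> S_set" "t \<in> S_set"
  shows "top_part (s * t) = top_part s * top_part t"
    and "corner_part (s * t) = top_part s * corner_part t + corner_part s * sq (top_part t)"
  using assms by (auto elim!: S_set_cases simp: coeff_mult_0)

lemma degree_mult_le_add: "degree p \<le> m \<Longrightarrow> degree q \<le> n \<Longrightarrow> degree (p * q) \<le> m + n"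
  using degree_mult_le[of p q] by linarith

lemma dimension_degree_bound:
  assumes "S.dimension n scalars (E :: 'k::field poly poly mat set)"
  shows "E \<subseteq> S_set \<and> (\<exists>B. \<forall>s\<in>E. degree (top_part s) \<le> B \<and> degree (corner_part s) \<le> B)"
  using assms
proof (induction n "scalars :: 'k poly poly mat set" E rule: S.dimension.induct)
  case zero_dim
  show ?case by (simp add: S_set_mat22)
next
  case (Suc_dim v E n)
  then obtain B where E: "E \<subseteq> S_set"
      "\<And>s. s \<in> E \<Longrightarrow> degree (top_part s) \<le> B \<and> degree (corner_part s) \<le> B" by blast
  define C where "C = max B (max (degree (top_part v)) (degree (corner_part v)))"
  have "s \<in> S_set \<and> degree (top_part s) \<le> C \<and> degree (corner_part s) \<le> C"
    if s: "s \<in> S.line_extension scalars v E" for s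
  proof -
    obtain c w where c: "c \<in> scalars" "w \<in> E" "s = c * v + w"
      using s by (auto simp: S.line_extension_mem_iff)
    have in_S: "c \<in> S_set" "v \<in> S_set" "w \<in> S_set"
      using c E(1) Suc_dim(1) scalars_subset by auto
    have cv: "c * v \<in> S_set" using S.m_closed[of c v] in_S by simp
    obtain r where "c = mat22 [:[:r:]:] 0 0 [:[:r:]:]" using c(1) by (auto simp: scalars_mat22)
    then have "top_part (c * v) = smult r (top_part v)" "corner_part (c * v) = smult r (corner_part v)"
      using parts_mult[OF in_S(1,2)] by simp_all
    then have "degree (top_part (c * v)) \<le> C" "degree (corner_part (c * v)) \<le> C"
      using degree_smult_le[of r "top_part v"] degree_smult_le[of r "corner_part v"]
      by (simp_all add: C_def)
    moreover have "degree (top_part w) \<le> C" "degree (corner_part w) \<le> C"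
      using E(2)[OF c(2)] by (simp_all add: C_def le_max_iff_disj)
    moreover have "s \<in> S_set" using S.a_closed[of "c * v" w] in_S cv c(3) by simp
    ultimately show ?thesis
      unfolding c(3) using cv in_S by (simp add: parts_add degree_add_le)
  qed
  then show ?case by blast
qed

lemma exponential_beats_linear: "\<exists>j. a + b * j < (2::nat) ^ j"
proof -
  define c where "c = a + b"
  have "a \<le> c" "b \<le> c" by (simp_all add: c_def)
  then have "a + b * (3 * c) \<le> c + c * (3 * c)" by (intro add_mono mult_right_mono) auto
  \<comment> \<open>The exponent \<open>j = 3 c\<close> suffices.\<close>
  also have "\<dots> < (c + 1) ^ 3" by (simp add: power3_eq_cube algebra_simps)
  also have "\<dots> \<le> (2 ^ c) ^ 3"
  proof (rule power_mono)
    show "c + 1 \<le> 2 ^ c" by (induction c) auto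
  qed simp
  also have "\<dots> = 2 ^ (3 * c)" by (simp add: power_mult[symmetric] mult.commute)
  finally show ?thesis by blast
qed

text \<open>The three stages of the proof: \<open>linear\<close> bounds the degrees of \<open>f\<close> on \<open>\<Gamma>\<^bsub>n\<^esub>\<close> linearly in \<open>n\<close>;
  \<open>ideal_bound\<close> says that on the ideal \<open>f = 0\<close> the degrees of \<open>g\<close> exceed those of \<open>f\<close> by at most a
  constant \<open>E\<close>, since this ideal is generated on the left by boundedly many leading terms; \<open>double\<close>
  multiplies \<open>e\<^bsub>12\<^esub>\<close>, which lies in this ideal, from the right, where degrees are doubled.  Iterating \<open>double\<close> gives
  exponential growth of the degrees of \<open>f\<close>.\<close>

lemma no_left_noetherian_filtration:
  fixes \<Gamma> :: "nat \<Rightarrow> 'k::field poly poly mat set"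
  assumes filt: "N_filtration scalars S_alg \<Gamma>" and fin: "finite_filtration scalars S_alg \<Gamma>"
    and noeth: "left_noetherian (gr S_alg \<Gamma>)"
  shows False
proof -
  interpret F: N_filtration scalars S_alg \<Gamma> by (rule filt)
  have carr: "s \<in> S_set" if "s \<in> \<Gamma> n" for s n using F.filt_carrier[OF that] by simp
  have bounded: "\<exists>B. \<forall>s\<in>\<Gamma> n. degree (top_part s) \<le> B \<and> degree (corner_part s) \<le> B" for n
  proof -
    obtain k where "S.dimension k scalars (\<Gamma> n)"
      using fin by (auto simp: finite_filtration_def S.finite_dimension_def)
    then show ?thesis using dimension_degree_bound by blast
  qed

  obtain B where linear: "\<And>n s. s \<in> \<Gamma> n \<Longrightarrow> degree (top_part s) \<le> B * (n + 1)"
  proof -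
    \<comment> \<open>Degree zero is left out, so that a product of \<open>a \<in> \<Gamma> (n - d)\<close> with \<open>b \<in> J d\<close> has \<open>a\<close> in smaller degree.\<close>
    define J where "J d = (if d = 0 then {} else \<Gamma> d)" for d
    have J: "J d \<subseteq> \<Gamma> d" for d by (simp add: J_def)
    obtain M where M: "\<And>n. J n \<subseteq> leading_span S_alg \<Gamma> J M n"
      using F.leading_span_stops[OF noeth J] by blast
    obtain B where B: "\<And>s. s \<in> \<Gamma> M \<Longrightarrow> degree (top_part s) \<le> B" using bounded[of M] by blast
    have "degree (top_part s) \<le> B * (n + 1)" if "s \<in> \<Gamma> n" for n s
      using that
    proof (induction n arbitrary: s rule: less_induct)
      case (less n)
      show ?case
      proof (cases "n \<le> M")
        case True
        then have "degree (top_part s) \<le> B" using B F.filt_mono[OF True] less.prems by blast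
        then show ?thesis by simp
      next
        case False
        then have "s \<in> leading_span S_alg \<Gamma> J M n" using M[of n] less.prems by (auto simp: J_def)
        then show ?thesis
        proof induction
          case (lower a)
          then have "a \<in> \<Gamma> (n - 1)" using False by (simp add: filt_pred_def split: nat.splits)
          from less.IH[OF _ this] False have "degree (top_part a) \<le> B * n" by simp
          then show ?case by simp
        next
          case (prod d a b)
          then have d: "d > 0" "b \<in> \<Gamma> d" by (auto simp: J_def split: if_splits)
          then have "b \<in> \<Gamma> M" using F.filt_mono[OF \<open>d \<le> M\<close>] by blast
          have "degree (top_part a) \<le> B * (n - d + 1)"
            using less.IH[OF _ \<open>a \<in> \<Gamma> (n - d)\<close>] d \<open>d \<le> n\<close> by simp
          then have "degree (top_part a * top_part b) \<le> B * (n - d + 1) + B"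
            using B[OF \<open>b \<in> \<Gamma> M\<close>] by (rule degree_mult_le_add)
          also have "\<dots> = B * (n - d + 2)" by (simp add: algebra_simps)
          also have "\<dots> \<le> B * (n + 1)" using d \<open>d \<le> n\<close> by (intro mult_le_mono2) simp
          finally show ?case using parts_mult[OF carr carr, OF \<open>a \<in> \<Gamma> (n - d)\<close> d(2)] by simp
        next
          case (add a b)
          then have "a \<in> S_set" "b \<in> S_set" using F.leading_span_filt[OF J] carr by blast+
          with add show ?case by (simp add: parts_add degree_add_le)
        qed
      qed
    qed
    then show ?thesis by (rule that)
  qed

  obtain E where ideal_bound: "\<And>n D t. \<lbrakk>\<And>s. s \<in> \<Gamma> n \<Longrightarrow> degree (top_part s) \<le> D;
      t \<in> \<Gamma> n; top_part t = 0\<rbrakk> \<Longrightarrow> degree (corner_part t) \<le> D + E"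
  proof -
    define J where "J d = {t \<in> \<Gamma> d. top_part t = 0}" for d
    have J: "J d \<subseteq> \<Gamma> d" for d by (auto simp: J_def)
    obtain M where M: "\<And>n. J n \<subseteq> leading_span S_alg \<Gamma> J M n"
      using F.leading_span_stops[OF noeth J] by blast
    obtain E where E: "\<And>s. s \<in> \<Gamma> M \<Longrightarrow> degree (corner_part s) \<le> E" using bounded[of M] by blast
    have "degree (corner_part t) \<le> D + E"
      if D: "\<And>s. s \<in> \<Gamma> n \<Longrightarrow> degree (top_part s) \<le> D" and "m \<le> n" "t \<in> J m" for n D m t
      using that(2,3)
    proof (induction m arbitrary: t)
      case 0
      then have "t \<in> \<Gamma> M" using F.filt_mono[of 0 M] J by blast
      then show ?case using E[of t] by simp
    next
      case (Suc m)
      have tm: "t \<in> \<Gamma> (Suc m)" "top_part t = 0" using Suc.prems by (auto simp: J_def)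
      show ?case
      proof (cases "Suc m \<le> M")
        case True
        then have "t \<in> \<Gamma> M" using F.filt_mono[OF True] tm by blast
        then show ?thesis using E[of t] by simp
      next
        case False
        have "t \<in> leading_span S_alg \<Gamma> J M (Suc m)" using M Suc.prems by blast
        \<comment> \<open>The remainder \<open>u\<close> from the lower step is again in the ideal, since \<open>t\<close> and \<open>v\<close> are.\<close>
        then have "\<exists>u\<in>\<Gamma> m. \<exists>v\<in>S_set. t = u + v \<and> top_part v = 0 \<and> degree (corner_part v) \<le> D + E"
        proof induction
          case (lower a)
          then have a: "a \<in> \<Gamma> m" by (simp add: filt_pred_def)
          moreover have "mat22 0 0 0 0 \<in> S_set" by (simp add: S_set_mat22)
          moreover have "a = a + mat22 0 0 0 0" using carr[OF a] by (auto elim!: S_set_cases)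
          ultimately show ?case by (intro bexI[of _ a] bexI[of _ "mat22 0 0 0 0"]) auto
        next
          case (prod d a b)
          have b: "b \<in> \<Gamma> d" "top_part b = 0" using prod by (auto simp: J_def)
          have ab: "a * b \<in> S_set"
            using F.filt_carrier[OF F.mult_in[OF \<open>a \<in> \<Gamma> (Suc m - d)\<close> b(1)]] by simp
          have "\<Gamma> (Suc m - d) \<subseteq> \<Gamma> n" using Suc.prems by (intro F.filt_mono) simp
          with prod have "a \<in> \<Gamma> n" by blast
          moreover have "b \<in> \<Gamma> M" using b F.filt_mono[OF \<open>d \<le> M\<close>] by blast
          ultimately have "degree (top_part a * corner_part b) \<le> D + E"
            using D E by (intro degree_mult_le_add)
          then have "top_part (a * b) = 0" "degree (corner_part (a * b)) \<le> D + E"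
            using parts_mult[OF carr carr, OF \<open>a \<in> \<Gamma> n\<close> b(1)] b by simp_all
          moreover have "a * b = mat22 0 0 0 0 + a * b" using ab by (auto elim!: S_set_cases)
          ultimately show ?case using F.filt_zero[of m] ab by auto
        next
          case (add a b)
          then obtain u v u' v' where uv: "u \<in> \<Gamma> m" "v \<in> S_set" "a = u + v" "top_part v = 0"
              "degree (corner_part v) \<le> D + E" "u' \<in> \<Gamma> m" "v' \<in> S_set" "b = u' + v'"
              "top_part v' = 0" "degree (corner_part v') \<le> D + E" by blast
          have "u + u' \<in> \<Gamma> m" using F.filt_add uv by simp
          moreover have "v + v' \<in> S_set" using S.a_closed[of v v'] uv by simp
          moreover have "u \<oplus>\<^bsub>S_alg\<^esub> v \<oplus>\<^bsub>S_alg\<^esub> (u' \<oplus>\<^bsub>S_alg\<^esub> v') = (u \<oplus>\<^bsub>S_alg\<^esub> u') \<oplus>\<^bsub>S_alg\<^esub> (v \<oplus>\<^bsub>S_alg\<^esub> v')"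
          proof -
            have "u \<in> carrier S_alg" "v \<in> carrier S_alg" "u' \<in> carrier S_alg" "v' \<in> carrier S_alg"
              using uv carr by auto
            then show ?thesis by (simp only: S.a_ac S.a_closed)
          qed
          ultimately show ?case
            using uv
            by (intro bexI[of _ "u + u'"] bexI[of _ "v + v'"]) (auto simp: parts_add degree_add_le)
        qed
        then obtain u v where uv: "u \<in> \<Gamma> m" "v \<in> S_set" "t = u + v" "top_part v = 0"
            "degree (corner_part v) \<le> D + E" by blast
        then have "top_part u = 0" using tm parts_add[OF carr[OF uv(1)] uv(2)] by simp
        then have "degree (corner_part u) \<le> D + E" using Suc.IH[of u] Suc.prems uv(1) by (simp add: J_def)
        then show ?thesis using uv parts_add[OF carr[OF uv(1)] uv(2)] by (simp add: degree_add_le)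
      qed
    qed
    then show ?thesis using that[of E] unfolding J_def by blast
  qed

  let ?e = "mat22 0 1 0 0 :: 'k poly poly mat"
  have "?e \<in> carrier S_alg" by (simp add: S_set_mat22)
  then obtain k where e: "?e \<in> \<Gamma> k" using F.exhaustive by blast
  have double: "\<exists>s'\<in>\<Gamma> (k + n). 2 * degree (top_part s) \<le> degree (top_part s') + E" if s: "s \<in> \<Gamma> n" for n s
  proof -
    have es: "?e * s \<in> \<Gamma> (k + n)" using F.mult_in[OF e s] by simp
    have parts: "top_part (?e * s) = 0" "corner_part (?e * s) = sq (top_part s)"
      using parts_mult[OF carr[OF e] carr[OF s]] by simp_all
    \<comment> \<open>The bound \<open>D\<close> is taken to be the attained maximum, so that it is the degree of an element.\<close>
    obtain C where "\<forall>s\<in>\<Gamma> (k + n). degree (top_part s) \<le> C" using bounded by blast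
    then have "\<forall>r. r \<in> \<Gamma> (k + n) \<longrightarrow> degree (top_part r) < Suc C"
      by (simp add: less_Suc_eq_le)
    from ex_has_greatest_nat[of "\<lambda>s. s \<in> \<Gamma> (k + n)", OF es this]
    obtain s' where s': "s' \<in> \<Gamma> (k + n)"
        "\<And>r. r \<in> \<Gamma> (k + n) \<Longrightarrow> degree (top_part r) \<le> degree (top_part s')"
      by auto
    have "degree (corner_part (?e * s)) \<le> degree (top_part s') + E"
      using s'(2) es parts(1) by (rule ideal_bound)
    then show ?thesis using s'(1) by (auto simp: parts degree_sq)
  qed

  \<comment> \<open>A starting degree above \<open>E\<close>, so that \<open>d \<mapsto> 2 d - E\<close> doubles the excess over \<open>E\<close>.\<close>
  define f :: "'k poly" where "f = monom 1 (E + 1)"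
  have "mat22 [:f:] 0 0 [:sq f:] \<in> carrier S_alg" by (simp add: S_set_mat22)
  then obtain m where m: "mat22 [:f:] 0 0 [:sq f:] \<in> \<Gamma> m" using F.exhaustive by blast
  have "\<exists>s\<in>\<Gamma> (m + j * k). E + 2 ^ j \<le> degree (top_part s)" for j
  proof (induction j)
    case 0
    show ?case using m by (auto simp: f_def degree_monom_eq intro!: bexI[of _ "mat22 [:f:] 0 0 [:sq f:]"])
  next
    case (Suc j)
    then obtain s where s: "s \<in> \<Gamma> (m + j * k)" "E + 2 ^ j \<le> degree (top_part s)" by blast
    obtain s' where s': "s' \<in> \<Gamma> (k + (m + j * k))" "2 * degree (top_part s) \<le> degree (top_part s') + E"
      using double[OF s(1)] by blast
    then show ?case using s(2) by (auto simp: algebra_simps intro!: bexI[of _ s'])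
  qed
  then have "2 ^ j \<le> B * (m + 1) + (B * k) * j" for j
  proof -
    obtain s where "s \<in> \<Gamma> (m + j * k)" "E + 2 ^ j \<le> degree (top_part s)"
      using \<open>\<And>j. \<exists>s\<in>\<Gamma> (m + j * k). E + 2 ^ j \<le> degree (top_part s)\<close> by blast
    with linear[of s "m + j * k"] show ?thesis by (simp add: algebra_simps)
  qed
  with exponential_beats_linear[of "B * (m + 1)" "B * k"] show False by (meson not_less)
qed

theorem mainTheorem5:
  shows "algebra_over (scalars :: 'k::field poly poly mat set) S_alg \<and>
         affine_algebra (scalars :: 'k poly poly mat set) S_alg \<and>
         left_noetherian (S_alg :: 'k poly poly mat ring) \<and>
         right_noetherian (S_alg :: 'k poly poly mat ring) \<and>
         prime_ring (S_alg :: 'k poly poly mat ring) \<and>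
         PI_algebra (scalars :: 'k poly poly mat set) S_alg \<and>
         \<not> (\<exists>\<Gamma>. N_filtration (scalars :: 'k poly poly mat set) S_alg \<Gamma> \<and>
                finite_filtration (scalars :: 'k poly poly mat set) S_alg \<Gamma> \<and>
                left_noetherian (gr (S_alg :: 'k poly poly mat ring) \<Gamma>))"
  using S_algebra S_affine S_left_noetherian S_right_noetherian S_prime S_PI
    no_left_noetherian_filtration by blast

end
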